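(* Let $Z$ be a random variable in $\mathbb R^n$ with log-concave distribution $\nu$ and let $G$ be a standard Gaussian random variable in $\mathbb R^n$ independent of $Z$. Then for all $0<\lambda\le1$, $$C_P(Z)\le\frac1\lambda\,C_P\big(\sqrt\lambda\,Z+\sqrt{1-\lambda}\,G\big)+\left(\frac1\lambda-1\right).$$
   Context: A probability measure $\nu$ on $\mathbb R^n$ is log-concave if $\nu(dx)=e^{-V(x)}dx$ with $V:\mathbb R^n\to\mathbb R\cup\{+\infty\}$ convex. For a random variable $X$ with law $\mu$, $C_P(X)=C_P(\mu)$ is the Poincaré constant: the smallest constant such that $\mathrm{Var}_\mu(f)\le C_P(\mu)\,\mu(|\nabla f|^2)$ for all Lipschitz (smooth) $f$. *)

theory Defs
  imports "HOL-Probability.Probability"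
begin

text \<open>Convexity for functions with values in \<open>\<real> \<union> {+\<infinity>}\<close>. Since \<open>V\<close> never takes the value
  \<open>-\<infinity>\<close> and \<open>0 * \<infinity> = 0\<close> in \<^typ>\<open>ereal\<close>, the right-hand side is always meaningful.\<close>

definition convex_ereal :: "('a::real_vector \<Rightarrow> ereal) \<Rightarrow> bool" where
  "convex_ereal V \<longleftrightarrow> (\<forall>x. V x \<noteq> -\<infinity>) \<and>
     (\<forall>x y. \<forall>t\<in>{0..1}. V ((1 - t) *\<^sub>R x + t *\<^sub>R y) \<le> ereal (1 - t) * V x + ereal t * V y)"

text \<open>The map \<open>v \<mapsto> e\<^sup>-\<^sup>v\<close> with \<open>e\<^sup>-\<^sup>\<infinity> = 0\<close>; it is only used for \<open>v \<noteq> -\<infinity>\<close>.\<close>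

definition exp_neg :: "ereal \<Rightarrow> ennreal" where
  "exp_neg v = (if v = \<infinity> then 0 else ennreal (exp (- real_of_ereal v)))"

text \<open>The density is with respect to Lebesgue measure. A convex function is Borel up to a
  modification on the (null) boundary of its domain, and the modification can be chosen convex,
  so asking for a Borel measurable \<open>V\<close> does not restrict the class of measures.\<close>

definition log_concave_measure :: "'a::euclidean_space measure \<Rightarrow> bool" where
  "log_concave_measure \<nu> \<longleftrightarrow> prob_space \<nu> \<and>
     (\<exists>V\<in>borel_measurable borel. convex_ereal V \<and> \<nu> = density lborel (\<lambda>x. exp_neg (V x)))"

definition std_gaussian_density :: "'a::euclidean_space \<Rightarrow> real" where
  "std_gaussian_density x = exp (- (norm x)\<^sup>2 / 2) / sqrt (2 * pi) ^ DIM('a)"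

primrec times_differentiable :: "nat \<Rightarrow> ('a::euclidean_space \<Rightarrow> real) \<Rightarrow> bool" where
  "times_differentiable 0 f \<longleftrightarrow> continuous_on UNIV f"
| "times_differentiable (Suc k) f \<longleftrightarrow> (\<forall>x. f differentiable (at x)) \<and>
     (\<forall>v. times_differentiable k (\<lambda>x. frechet_derivative f (at x) v))"

definition smooth :: "('a::euclidean_space \<Rightarrow> real) \<Rightarrow> bool" where
  "smooth f \<longleftrightarrow> (\<forall>k. times_differentiable k f)"

definition gradient :: "('a::euclidean_space \<Rightarrow> real) \<Rightarrow> 'a \<Rightarrow> 'a" where
  "gradient f x = (THE D. GDERIV f x :> D)"

text \<open>Extended-valued variance, equal to \<open>\<infinity>\<close> if \<open>f\<close> is not square integrable. This also covers
  \<open>f\<close> not integrable, where the Bochner integral has the default value \<open>0\<close>.\<close>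

definition ext_variance :: "'a measure \<Rightarrow> ('a \<Rightarrow> real) \<Rightarrow> ennreal" where
  "ext_variance \<mu> f = (\<integral>\<^sup>+x. ennreal ((f x - (\<integral>y. f y \<partial>\<mu>))\<^sup>2) \<partial>\<mu>)"

definition poincare_inequality :: "'a::euclidean_space measure \<Rightarrow> ennreal \<Rightarrow> bool" where
  "poincare_inequality \<mu> C \<longleftrightarrow>
     (\<forall>f. (\<exists>L. L-lipschitz_on UNIV f) \<and> smooth f \<longrightarrow>
        ext_variance \<mu> f \<le> C * (\<integral>\<^sup>+x. ennreal ((norm (gradient f x))\<^sup>2) \<partial>\<mu>))"

text \<open>The value is \<open>\<infinity>\<close> if no finite constant is admissible.\<close>

definition poincare_constant :: "'a::euclidean_space measure \<Rightarrow> ennreal" where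
  "poincare_constant \<mu> = Inf {C. poincare_inequality \<mu> C}"

end

theory Submission
  imports Defs
begin

text \<open>
  For \<open>r = 1\<close> there is no noise and nothing to show. For \<open>r < 1\<close> condition \<open>Z\<close> on the noisy observation \<open>Y = sqrt r *\<^sub>R Z + sqrt (1 - r) *\<^sub>R G\<close>. Write
  \<open>\<kappa> = r / (1 - r)\<close> and \<open>c = sqrt r / (1 - r)\<close>. By Bayes' rule, the law \<open>\<mu>\<^sub>y\<close> of \<open>Z\<close> given \<open>Y = y\<close> has
  a density proportional to the density of \<open>Z\<close> times \<open>exp (- \<kappa> / 2 * |z|^2 + c * (z \<bullet> y))\<close>. Since \<open>Z\<close> is
  log-concave, \<open>\<mu>\<^sub>y\<close> is more log-concave than a Gaussian of covariance \<open>1 / \<kappa>\<close>, and therefore its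
  Poincare constant is at most \<open>1 / \<kappa> = 1 / r - 1\<close>, whatever \<open>y\<close> is.

  Let \<open>F y\<close> be the mean of \<open>f\<close> under \<open>\<mu>\<^sub>y\<close>. The law of total variance bounds the variance of \<open>f Z\<close> by
  the average of the variances of \<open>f\<close> under \<open>\<mu>\<^sub>y\<close>, which is at most \<open>(1 / r - 1) * E |grad f|^2\<close>, plus
  the variance of \<open>F Y\<close>, which is at most \<open>C * E |grad F|^2\<close> for every constant \<open>C\<close> admissible for
  \<open>Y\<close>. Differentiating in \<open>y\<close> gives \<open>u \<bullet> grad F y = c * Cov (f, z \<bullet> u)\<close>, the covariance being
  taken under \<open>\<mu>\<^sub>y\<close>. The Cauchy-Schwarz inequality, followed by the Poincare inequality of \<open>\<mu>\<^sub>y\<close> for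
  \<open>f\<close> and for the linear function \<open>z \<bullet> u\<close>, gives \<open>|grad F y|^2 \<le> (c / \<kappa>)^2 * \<integral> |grad f|^2 d\<mu>\<^sub>y\<close>, and
  \<open>(c / \<kappa>)^2 = 1 / r\<close>. Adding the two contributions gives the constant \<open>C / r + (1 / r - 1)\<close>
  (\<open>poincare_inequality_transfer\<close>).

  The Poincare inequality for \<open>\<mu>\<^sub>y\<close> (\<open>poincare_uniformly_log_concave\<close>) is obtained without any
  smoothness of the density, following Maurey and Bobkov-Ledoux: the Prekopa-Leindler inequality
  yields an inequality between exponential integrals of \<open>- e * g\<close> and of a quadratic infimum
  convolution of \<open>e * g\<close>, and its second-order expansion at \<open>e = 0\<close> is the Poincare inequality.

  The function \<open>F\<close> has to be smooth and Lipschitz to be tested against the Poincare inequality of \<open>Y\<close>.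
  It is a quotient of two Laplace transforms of a measure with Gaussian tails, and such
  transforms are smooth (\<open>times_differentiable_laplace_transform\<close>); its Lipschitz constant comes from the
  same gradient bound.
\<close>


section \<open>The Prekopa-Leindler inequality\<close>

lemma emeasure_lborel_translate:
  fixes A :: "real set"
  assumes [measurable]: "A \<in> sets borel"
  shows "emeasure lborel {x. x - a \<in> A} = emeasure lborel A"
proof -
  have "emeasure lborel A = emeasure (distr lborel borel ((+) (-a))) A"
    by (simp add: lborel_distr_plus)
  also have "\<dots> = emeasure lborel {x. x - a \<in> A}"
    by (subst emeasure_distr) (auto intro!: arg_cong[where f="emeasure lborel"])
  finally show ?thesis ..
qed

text \<open>Choose \<open>a\<close> in \<open>A\<close> close to its supremum and \<open>b\<close> in \<open>B\<close> close to its infimum. The translates \<open>A + b\<close>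
  and \<open>a + B\<close> both lie in \<open>C\<close>, and they overlap in an interval of length at most \<open>e\<close>, so the sum of
  their lengths exceeds the length of \<open>C\<close> by at most \<open>e\<close>.\<close>

lemma brunn_minkowski_real_bounded:
  fixes A B C :: "real set"
  assumes [measurable]: "A \<in> sets borel" "B \<in> sets borel" "C \<in> sets borel"
    and ne: "A \<noteq> {}" "B \<noteq> {}" and bdd: "bdd_above A" "bdd_below B"
    and sum: "\<And>a b. a \<in> A \<Longrightarrow> b \<in> B \<Longrightarrow> a + b \<in> C"
  shows "emeasure lborel A + emeasure lborel B \<le> emeasure lborel C"
proof (rule ennreal_le_epsilon)
  fix e :: real assume "0 < e"
  obtain a where a: "a \<in> A" "Sup A - e/2 < a"
    using less_cSup_iff[OF ne(1) bdd(1), of "Sup A - e/2"] \<open>0 < e\<close> by auto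
  obtain b where b: "b \<in> B" "b < Inf B + e/2"
    using cInf_less_iff[OF ne(2) bdd(2), of "Inf B + e/2"] \<open>0 < e\<close> by auto
  let ?S = "{x. x - b \<in> A}" and ?T = "{x. x - a \<in> B}"
  have "?S \<inter> ?T \<subseteq> {a + Inf B .. b + Sup A}"
  proof
    fix x assume "x \<in> ?S \<inter> ?T"
    then have "x - b \<le> Sup A" "Inf B \<le> x - a"
      using cSup_upper[OF _ bdd(1)] cInf_lower[OF _ bdd(2)] by auto
    then show "x \<in> {a + Inf B .. b + Sup A}"
      by auto
  qed
  then have "emeasure lborel (?S \<inter> ?T) \<le> emeasure lborel {a + Inf B .. b + Sup A}"
    by (intro emeasure_mono) auto
  also have "\<dots> \<le> ennreal e"
    using a b \<open>0 < e\<close> by (auto simp: emeasure_lborel_Icc_eq intro!: ennreal_leI)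
  finally have small: "emeasure lborel (?S \<inter> ?T) \<le> ennreal e" .
  have "?S \<union> ?T \<subseteq> C"
    using sum a(1) b(1) by (auto) (metis diff_add_cancel add.commute)+
  then have "emeasure lborel (?S \<union> ?T) \<le> emeasure lborel C"
    by (intro emeasure_mono) auto
  then show "emeasure lborel A + emeasure lborel B \<le> emeasure lborel C + ennreal e"
    using small emeasure_Un_Int[of ?S lborel ?T]
    by (simp add: emeasure_lborel_translate add_mono)
qed

text \<open>Cutting \<open>A\<close> off from above and \<open>B\<close> from below reduces to the bounded case, and the lengths of the pieces
  increase to those of \<open>A\<close> and \<open>B\<close>.\<close>

lemma brunn_minkowski_real:
  fixes A B C :: "real set"
  assumes [measurable]: "A \<in> sets borel" "B \<in> sets borel" "C \<in> sets borel"
    and ne: "A \<noteq> {}" "B \<noteq> {}"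
    and sum: "\<And>a b. a \<in> A \<Longrightarrow> b \<in> B \<Longrightarrow> a + b \<in> C"
  shows "emeasure lborel A + emeasure lborel B \<le> emeasure lborel C"
proof -
  obtain a b where ab: "a \<in> A" "b \<in> B"
    using ne by auto
  let ?A = "\<lambda>n::nat. A \<inter> {..real n}" and ?B = "\<lambda>n::nat. B \<inter> {- real n..}"
  have UA: "(\<Union>n. ?A n) = A" and UB: "(\<Union>n. ?B n) = B"
    by (auto simp: real_arch_simple) (metis minus_le_iff real_arch_simple)
  have "(\<lambda>n. emeasure lborel (?A n)) \<longlonglongrightarrow> emeasure lborel (\<Union>n. ?A n)"
    by (rule Lim_emeasure_incseq) (auto simp: incseq_def)
  moreover have "(\<lambda>n. emeasure lborel (?B n)) \<longlonglongrightarrow> emeasure lborel (\<Union>n. ?B n)"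
    by (rule Lim_emeasure_incseq) (auto simp: incseq_def)
  ultimately have lim: "(\<lambda>n. emeasure lborel (?A n) + emeasure lborel (?B n))
      \<longlonglongrightarrow> emeasure lborel A + emeasure lborel B"
    unfolding UA UB by (rule tendsto_add)
  obtain N :: nat where N: "a \<le> real N" "- b \<le> real N"
    using real_arch_simple[of "max a (- b)"] by auto
  show ?thesis
  proof (rule LIMSEQ_le_const2[OF lim], intro exI allI impI)
    fix n assume "N \<le> n"
    then have "a \<in> ?A n" "b \<in> ?B n"
      using N ab by (auto intro: order_trans)
    then show "emeasure lborel (?A n) + emeasure lborel (?B n) \<le> emeasure lborel C"
      using sum by (intro brunn_minkowski_real_bounded) auto
  qed
qed

text \<open>Only levels below \<open>1\<close> are counted, which truncates \<open>h\<close> at \<open>1\<close>.\<close>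

lemma nn_integral_layer_cake:
  fixes h :: "real \<Rightarrow> ennreal"
  assumes [measurable]: "h \<in> borel_measurable borel"
  shows "(\<integral>\<^sup>+t\<in>{0<..<1}. emeasure lborel {x. ennreal t < h x} \<partial>lborel) = (\<integral>\<^sup>+x. min 1 (h x) \<partial>lborel)"
proof -
  have "(\<integral>\<^sup>+t\<in>{0<..<1}. emeasure lborel {x. ennreal t < h x} \<partial>lborel)
      = (\<integral>\<^sup>+t. (\<integral>\<^sup>+x. indicator {0<..<1} t * indicator {x. ennreal t < h x} x \<partial>lborel) \<partial>lborel)"
    by (intro nn_integral_cong) (simp add: nn_integral_cmult mult.commute)
  also have "\<dots> = (\<integral>\<^sup>+x. (\<integral>\<^sup>+t. indicator {0<..<1} t * indicator {x. ennreal t < h x} x \<partial>lborel) \<partial>lborel)"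
    by (rule lborel_pair.Fubini') (measurable)
  also have "\<dots> = (\<integral>\<^sup>+x. min 1 (h x) \<partial>lborel)"
  proof (rule nn_integral_cong)
    fix x
    define u where "u = enn2real (min 1 (h x))"
    have "min 1 (h x) \<noteq> top"
      by (auto simp: min_def top_unique)
    then have u: "ennreal u = min 1 (h x)" "0 \<le> u"
      by (auto simp: u_def less_top)
    have *: "0 < t \<Longrightarrow> (t < 1 \<and> ennreal t < h x) \<longleftrightarrow> t < u" for t
      using u ennreal_less_iff[of t u] ennreal_less_iff[of t 1] by (auto simp: min_less_iff_conj)
    have "(\<integral>\<^sup>+t. indicator {0<..<1} t * indicator {x. ennreal t < h x} x \<partial>lborel)
        = (\<integral>\<^sup>+t. indicator {0<..<u} t \<partial>lborel)"
      using * by (intro nn_integral_cong) (auto simp: indicator_def)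
    also have "\<dots> = min 1 (h x)"
      using u by simp
    finally show "(\<integral>\<^sup>+t. indicator {0<..<1} t * indicator {x. ennreal t < h x} x \<partial>lborel) = min 1 (h x)" .
  qed
  finally show ?thesis .
qed

text \<open>When \<open>f\<close> and \<open>g\<close> have the same supremum \<open>1\<close>, all their superlevel sets at levels \<open>t < 1\<close> are non-empty.
  The hypothesis says that the superlevel set of \<open>h\<close> contains the sum of those of \<open>f\<close> and \<open>g\<close>, so the
  one-dimensional Brunn-Minkowski inequality applies level by level. The normalization turns the
  multiplicative conclusion into an additive one.\<close>

lemma prekopa_leindler_normalized:
  fixes f g h :: "real \<Rightarrow> ennreal"
  assumes [measurable]: "f \<in> borel_measurable borel" "g \<in> borel_measurable borel"
      "h \<in> borel_measurable borel"
    and f: "(SUP x. f x) = 1" and g: "(SUP x. g x) = 1"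
    and le: "\<And>x y. f x * g y \<le> (h (x + y))\<^sup>2"
  shows "(\<integral>\<^sup>+x. f x \<partial>lborel) + (\<integral>\<^sup>+x. g x \<partial>lborel) \<le> (\<integral>\<^sup>+x. h x \<partial>lborel)"
proof -
  let ?l = "\<lambda>h t. emeasure lborel {x. ennreal t < h x} * indicator {0<..<1} t"
  have [measurable]: "?l f \<in> borel_measurable lborel" "?l g \<in> borel_measurable lborel"
    by measurable
  have le1: "f x \<le> 1" "g x \<le> 1" for x
    using f g by (metis SUP_upper UNIV_I)+
  then have eq: "min 1 (f x) = f x" "min 1 (g x) = g x" for x
    by (auto simp: min_absorb2)
  have "(\<integral>\<^sup>+x. f x \<partial>lborel) + (\<integral>\<^sup>+x. g x \<partial>lborel) = (\<integral>\<^sup>+t. ?l f t + ?l g t \<partial>lborel)"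
    using nn_integral_layer_cake[of f] nn_integral_layer_cake[of g]
    by (subst nn_integral_add) (simp_all add: eq)
  also have "\<dots> \<le> (\<integral>\<^sup>+t. ?l h t \<partial>lborel)"
  proof (rule nn_integral_mono)
    fix t :: real
    have "emeasure lborel {x. ennreal t < f x} + emeasure lborel {x. ennreal t < g x}
        \<le> emeasure lborel {x. ennreal t < h x}" if t: "0 < t" "t < 1"
    proof (rule brunn_minkowski_real)
      have "ennreal t < 1"
        using t by (simp add: ennreal_less_one_iff)
      then show "{x. ennreal t < f x} \<noteq> {}" "{x. ennreal t < g x} \<noteq> {}"
        using less_SUP_iff[of "ennreal t" f UNIV] less_SUP_iff[of "ennreal t" g UNIV] f g by auto
      fix a b assume "a \<in> {x. ennreal t < f x}" "b \<in> {x. ennreal t < g x}"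
      then have ab: "ennreal t < f a" "ennreal t < g b"
        by auto
      show "a + b \<in> {x. ennreal t < h x}"
      proof (rule ccontr)
        assume "a + b \<notin> {x. ennreal t < h x}"
        then have "(h (a + b))\<^sup>2 \<le> (ennreal t)\<^sup>2"
          by (intro power_mono) auto
        then have *: "f a * g b \<le> ennreal (t * t)"
          using le[of a b] t by (simp add: power2_eq_square ennreal_mult)
        have "f a \<noteq> top" "g b \<noteq> top"
          using le1(1)[of a] le1(2)[of b] by (auto simp: top_unique)
        then obtain u v where "f a = ennreal u" "g b = ennreal v" "0 \<le> u" "0 \<le> v"
          by (metis ennreal_cases)
        then show False
          using * ab t mult_strict_mono[of t u t v]
          by (simp add: ennreal_mult[symmetric] ennreal_less_iff not_le[symmetric])
      qed
    qed measurable
    then show "?l f t + ?l g t \<le> ?l h t"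
      by (auto simp: indicator_def)
  qed
  also have "\<dots> \<le> (\<integral>\<^sup>+x. h x \<partial>lborel)"
    by (subst nn_integral_layer_cake) (auto intro!: nn_integral_mono)
  finally show ?thesis .
qed

lemma arith_geo_mean_ennreal:
  fixes p q :: ennreal
  shows "4 * (p * q) \<le> (p + q)\<^sup>2"
proof (cases "p = top \<or> q = top")
  case True
  then show ?thesis by (auto simp: power2_eq_square)
next
  case False
  then obtain a b where ab: "p = ennreal a" "q = ennreal b" "0 \<le> a" "0 \<le> b"
    by (metis ennreal_cases)
  have "4 * (a * b) \<le> (a + b)\<^sup>2"
    using sum_squares_ge_zero[of "a - b" 0] by (simp add: power2_eq_square algebra_simps)
  moreover have "4 * (p * q) = ennreal (4 * (a * b))" "(p + q)\<^sup>2 = ennreal ((a + b)\<^sup>2)"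
    using ab by (simp_all add: ennreal_mult ennreal_power flip: ennreal_plus)
  ultimately show ?thesis
    by (simp add: ennreal_leI)
qed

text \<open>Dividing \<open>f\<close> and \<open>g\<close> by their suprema reduces to the normalized case; the product form is
  recovered from the additive one by the arithmetic-geometric mean inequality.\<close>

lemma prekopa_leindler_real_bounded:
  fixes f g h :: "real \<Rightarrow> ennreal"
  assumes [measurable]: "f \<in> borel_measurable borel" "g \<in> borel_measurable borel"
      "h \<in> borel_measurable borel"
    and f: "\<And>x. f x \<le> ennreal m" and g: "\<And>x. g x \<le> ennreal n"
    and le: "\<And>x y. f x * g y \<le> (h ((x + y) / 2))\<^sup>2"
  shows "(\<integral>\<^sup>+x. f x \<partial>lborel) * (\<integral>\<^sup>+x. g x \<partial>lborel) \<le> (\<integral>\<^sup>+x. h x \<partial>lborel)\<^sup>2"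
proof (cases "(\<forall>x. f x = 0) \<or> (\<forall>x. g x = 0)")
  case True
  then show ?thesis by auto
next
  case False
  have "(SUP x. f x) \<le> ennreal m" "(SUP x. g x) \<le> ennreal n"
    using f g by (auto intro: SUP_least)
  moreover have "(SUP x. f x) \<noteq> 0" "(SUP x. g x) \<noteq> 0"
    using False by (auto simp: SUP_eq_iff bot_ennreal[symmetric] simp del: bot_ennreal)
  ultimately obtain a b where ab: "(SUP x. f x) = ennreal a" "(SUP x. g x) = ennreal b" "0 < a" "0 < b"
    by (metis ennreal_cases ennreal_eq_0_iff leI neq_top_trans ennreal_neq_top)
  have c: "ennreal (1 / sqrt (a * b)) * ennreal (1 / sqrt (a * b)) = ennreal (1 / a) * ennreal (1 / b)"
    using ab by (simp add: ennreal_mult[symmetric] real_sqrt_mult[symmetric] flip: real_sqrt_mult)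
  define F G H where "F = (\<integral>\<^sup>+x. f x \<partial>lborel)" and "G = (\<integral>\<^sup>+x. g x \<partial>lborel)"
    and "H = (\<integral>\<^sup>+x. h x \<partial>lborel)"
  have H: "(\<integral>\<^sup>+x. h (x / 2) \<partial>lborel) = 2 * H"
    unfolding H_def using nn_integral_real_affine[of "\<lambda>x. h (x / 2)" 2 0] by simp
  have "(\<integral>\<^sup>+x. ennreal (1 / a) * f x \<partial>lborel) + (\<integral>\<^sup>+x. ennreal (1 / b) * g x \<partial>lborel)
     \<le> (\<integral>\<^sup>+x. ennreal (1 / sqrt (a * b)) * h (x / 2) \<partial>lborel)"
  proof (rule prekopa_leindler_normalized)
    show "(SUP x. ennreal (1 / a) * f x) = 1" "(SUP x. ennreal (1 / b) * g x) = 1"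
      using ab by (simp_all add: SUP_mult_left_ennreal[symmetric] ennreal_mult[symmetric])
    fix x y
    have "ennreal (1 / a) * f x * (ennreal (1 / b) * g y) = ennreal (1 / a) * ennreal (1 / b) * (f x * g y)"
      by (simp add: ac_simps)
    also have "\<dots> \<le> ennreal (1 / a) * ennreal (1 / b) * (h ((x + y) / 2))\<^sup>2"
      by (intro mult_left_mono le) auto
    also have "\<dots> = (ennreal (1 / sqrt (a * b)) * h ((x + y) / 2))\<^sup>2"
      by (simp add: c[symmetric] power2_eq_square ac_simps)
    finally show "ennreal (1 / a) * f x * (ennreal (1 / b) * g y)
        \<le> (ennreal (1 / sqrt (a * b)) * h ((x + y) / 2))\<^sup>2" .
  qed measurable
  then have "ennreal (1 / a) * F + ennreal (1 / b) * G \<le> ennreal (1 / sqrt (a * b)) * (2 * H)"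
    by (simp add: nn_integral_cmult H F_def G_def)
  then have "(ennreal (1 / a) * F + ennreal (1 / b) * G)\<^sup>2 \<le> (ennreal (1 / sqrt (a * b)) * (2 * H))\<^sup>2"
    by (intro power_mono) auto
  \<comment> \<open>The scaling factors of \<open>f\<close>, \<open>g\<close> and \<open>h\<close> match, so they cancel after squaring.\<close>
  then have "4 * (ennreal (1 / a) * F * (ennreal (1 / b) * G)) \<le> (ennreal (1 / sqrt (a * b)) * (2 * H))\<^sup>2"
    using arith_geo_mean_ennreal order_trans by blast
  also have "\<dots> = ennreal (1 / a) * ennreal (1 / b) * 4 * H\<^sup>2"
    by (simp add: c[symmetric] power2_eq_square ac_simps)
  finally have "ennreal (1 / a) * ennreal (1 / b) * 4 * (F * G) \<le> ennreal (1 / a) * ennreal (1 / b) * 4 * H\<^sup>2"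
    by (simp add: ac_simps)
  moreover have "ennreal (1 / a) * ennreal (1 / b) * 4 = ennreal (4 / (a * b))"
    using ab by (simp add: ennreal_mult[symmetric] flip: ennreal_numeral)
  ultimately have "ennreal (4 / (a * b)) * (F * G) \<le> ennreal (4 / (a * b)) * H\<^sup>2"
    by simp
  then have "ennreal (a * b / 4) * (ennreal (4 / (a * b)) * (F * G))
      \<le> ennreal (a * b / 4) * (ennreal (4 / (a * b)) * H\<^sup>2)"
    by (rule mult_left_mono) simp
  then show ?thesis
    using ab by (simp add: mult.assoc[symmetric] ennreal_mult[symmetric] F_def G_def H_def)
qed

lemma nn_integral_truncate:
  assumes [measurable]: "f \<in> borel_measurable M"
  shows "(SUP n. \<integral>\<^sup>+x. min (f x) (ennreal (real n)) \<partial>M) = (\<integral>\<^sup>+x. f x \<partial>M)"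
proof -
  have "(SUP n. \<integral>\<^sup>+x. min (f x) (ennreal (real n)) \<partial>M) = (\<integral>\<^sup>+x. (SUP n. min (f x) (ennreal (real n))) \<partial>M)"
    by (rule nn_integral_monotone_convergence_SUP[symmetric])
       (auto simp: incseq_def le_fun_def intro!: min.coboundedI2 ennreal_leI)
  also have "\<dots> = (\<integral>\<^sup>+x. f x \<partial>M)"
  proof (rule nn_integral_cong)
    fix x
    have "(SUP n. min (f x) (ennreal (real n))) = min (f x) (SUP n. ennreal (real n))"
      by (simp add: inf_min[symmetric] inf_SUP)
    then show "(SUP n. min (f x) (ennreal (real n))) = f x"
      by (simp add: ennreal_SUP_of_nat_eq_top ennreal_of_nat_eq_real_of_nat[symmetric])
  qed
  finally show ?thesis .
qed

text \<open>Truncating \<open>f\<close> and \<open>g\<close> preserves the hypothesis, and the two truncation levels tend to infinity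
  independently.\<close>

lemma prekopa_leindler_real:
  fixes f g h :: "real \<Rightarrow> ennreal"
  assumes [measurable]: "f \<in> borel_measurable borel" "g \<in> borel_measurable borel"
      "h \<in> borel_measurable borel"
    and le: "\<And>x y. f x * g y \<le> (h ((x + y) / 2))\<^sup>2"
  shows "(\<integral>\<^sup>+x. f x \<partial>lborel) * (\<integral>\<^sup>+x. g x \<partial>lborel) \<le> (\<integral>\<^sup>+x. h x \<partial>lborel)\<^sup>2"
proof -
  let ?F = "\<lambda>n::nat. \<integral>\<^sup>+x. min (f x) (ennreal (real n)) \<partial>lborel"
  let ?G = "\<lambda>n::nat. \<integral>\<^sup>+x. min (g x) (ennreal (real n)) \<partial>lborel"
  have "?F m * ?G n \<le> (\<integral>\<^sup>+x. h x \<partial>lborel)\<^sup>2" for m n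
    by (rule prekopa_leindler_real_bounded[where m="real m" and n="real n"])
       (auto intro: order_trans[OF mult_mono le])
  then have "(SUP m. ?F m) * (SUP n. ?G n) \<le> (\<integral>\<^sup>+x. h x \<partial>lborel)\<^sup>2"
    by (simp add: SUP_mult_left_ennreal SUP_mult_right_ennreal SUP_le_iff)
  then show ?thesis
    by (simp add: nn_integral_truncate)
qed

text \<open>Induction on the set of coordinates: if \<open>x\<close> and \<open>y\<close> are fixed in all coordinates but one, the
  one-dimensional inequality for the slices is exactly the hypothesis for the functions obtained by
  integrating out that coordinate.\<close>

lemma prekopa_leindler_PiM:
  assumes "finite I"
    and "f \<in> borel_measurable (PiM I (\<lambda>_. lborel))" "g \<in> borel_measurable (PiM I (\<lambda>_. lborel))"
      "h \<in> borel_measurable (PiM I (\<lambda>_. lborel))"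
    and "\<And>x y. x \<in> space (PiM I (\<lambda>_. lborel)) \<Longrightarrow> y \<in> space (PiM I (\<lambda>_. lborel)) \<Longrightarrow>
        f x * g y \<le> (h (\<lambda>i\<in>I. (x i + y i) / 2 :: real))\<^sup>2"
  shows "(\<integral>\<^sup>+x. f x \<partial>PiM I (\<lambda>_. lborel)) * (\<integral>\<^sup>+x. g x \<partial>PiM I (\<lambda>_. lborel))
      \<le> (\<integral>\<^sup>+x. h x \<partial>PiM I (\<lambda>_. lborel))\<^sup>2"
  using assms
proof (induction I arbitrary: f g h rule: finite_induct)
  case empty
  interpret product_sigma_finite "\<lambda>_. lborel :: real measure" ..
  show ?case
    using empty(4)[of "\<lambda>_. undefined" "\<lambda>_. undefined"]
    by (simp add: nn_integral_empty space_PiM restrict_def)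
next
  case (insert i I)
  interpret product_sigma_finite "\<lambda>_. lborel :: real measure" ..
  note [measurable] = insert.prems(1-3)
  let ?P = "PiM I (\<lambda>_. lborel :: real measure)"
  have slice: "x(i := t) \<in> space (PiM (insert i I) (\<lambda>_. lborel))" if "x \<in> space ?P" for x and t :: real
    using that by (auto simp: space_PiM PiE_def extensional_def)
  have "(\<integral>\<^sup>+x. (\<integral>\<^sup>+t. f (x(i := t)) \<partial>lborel) \<partial>?P) * (\<integral>\<^sup>+x. (\<integral>\<^sup>+t. g (x(i := t)) \<partial>lborel) \<partial>?P)
      \<le> (\<integral>\<^sup>+x. (\<integral>\<^sup>+t. h (x(i := t)) \<partial>lborel) \<partial>?P)\<^sup>2"
  proof (rule insert.IH)
    fix x y assume x: "x \<in> space ?P" and y: "y \<in> space ?P"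
    let ?z = "\<lambda>i\<in>I. (x i + y i) / 2"
    have z: "?z \<in> space ?P"
      by (auto simp: space_PiM)
    have meas: "(\<lambda>t. u (x(i := t))) \<in> borel_measurable borel"
      if "u \<in> borel_measurable (PiM (insert i I) (\<lambda>_. lborel))" "x \<in> space ?P"
      for u :: "('a \<Rightarrow> real) \<Rightarrow> ennreal" and x
    proof -
      have "(\<lambda>t. x(i := t)) \<in> lborel \<rightarrow>\<^sub>M PiM (insert i I) (\<lambda>_. lborel)"
        using that by (intro measurable_fun_upd[where J=I]) auto
      then show ?thesis
        using measurable_compose[OF _ that(1)] by simp
    qed
    have mid: "(\<lambda>j\<in>insert i I. ((x(i := s)) j + (y(i := t)) j) / 2) = ?z(i := (s + t) / 2)" for s t
      using \<open>i \<notin> I\<close> by (auto simp: fun_eq_iff)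
    show "(\<integral>\<^sup>+t. f (x(i := t)) \<partial>lborel) * (\<integral>\<^sup>+t. g (y(i := t)) \<partial>lborel)
        \<le> (\<integral>\<^sup>+t. h (?z(i := t)) \<partial>lborel)\<^sup>2"
    proof (rule prekopa_leindler_real)
      show "f (x(i := s)) * g (y(i := t)) \<le> (h (?z(i := (s + t) / 2)))\<^sup>2" for s t
        using insert.prems(4)[OF slice[OF x] slice[OF y], of s t] unfolding mid .
    qed (auto intro!: meas insert.prems x y z)
  qed measurable
  then show ?case
    using insert.hyps insert.prems by (simp add: product_nn_integral_insert)
qed

theorem prekopa_leindler:
  fixes f g h :: "'a::euclidean_space \<Rightarrow> ennreal"
  assumes [measurable]: "f \<in> borel_measurable borel" "g \<in> borel_measurable borel"
      "h \<in> borel_measurable borel"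
    and le: "\<And>x y. f x * g y \<le> (h ((x + y) /\<^sub>R 2))\<^sup>2"
  shows "(\<integral>\<^sup>+x. f x \<partial>lborel) * (\<integral>\<^sup>+x. g x \<partial>lborel) \<le> (\<integral>\<^sup>+x. h x \<partial>lborel)\<^sup>2"
proof -
  let ?T = "\<lambda>x. \<Sum>b\<in>Basis. x b *\<^sub>R (b :: 'a)"
  have eq: "(\<integral>\<^sup>+x. u x \<partial>lborel) = (\<integral>\<^sup>+x. u (?T x) \<partial>PiM Basis (\<lambda>_. lborel))"
    if "u \<in> borel_measurable borel" for u :: "'a \<Rightarrow> ennreal"
    using that by (subst lborel_eq) (simp add: nn_integral_distr)
  have "(\<integral>\<^sup>+x. f (?T x) \<partial>PiM Basis (\<lambda>_. lborel)) * (\<integral>\<^sup>+x. g (?T x) \<partial>PiM Basis (\<lambda>_. lborel))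
      \<le> (\<integral>\<^sup>+x. h (?T x) \<partial>PiM Basis (\<lambda>_. lborel))\<^sup>2"
  proof (rule prekopa_leindler_PiM)
    fix x y :: "'a \<Rightarrow> real"
    have "?T (\<lambda>i\<in>Basis. (x i + y i) / 2) = (?T x + ?T y) /\<^sub>R 2"
      unfolding sum.distrib[symmetric] scaleR_sum_right
      by (intro sum.cong) (simp_all add: scaleR_add_left scaleR_add_right add_divide_distrib inverse_eq_divide)
    then show "f (?T x) * g (?T y) \<le> (h (?T (\<lambda>i\<in>Basis. (x i + y i) / 2)))\<^sup>2"
      using le[of "?T x" "?T y"] by simp
  qed measurable
  then show ?thesis
    by (simp add: eq)
qed

section \<open>Functions of exponential growth\<close>

text \<open>The class is an algebra containing Lipschitz functions, their exponentials and linear functions, and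
  its members are integrable against every measure with exponential moments; all integrability
  questions below are settled by membership in it.\<close>

definition exp_growth :: "('a::euclidean_space \<Rightarrow> real) \<Rightarrow> bool" where
  "exp_growth u \<longleftrightarrow> u \<in> borel_measurable borel \<and> (\<exists>K\<ge>0. \<exists>a\<ge>0. \<forall>x. \<bar>u x\<bar> \<le> K * exp (a * norm x))"

lemma exp_growthI:
  assumes "u \<in> borel_measurable borel" "\<And>x. \<bar>u x\<bar> \<le> K * exp (a * norm x)" "0 \<le> K" "0 \<le> a"
  shows "exp_growth u"
  using assms unfolding exp_growth_def by blast

lemma exp_growth_measurable: "exp_growth u \<Longrightarrow> u \<in> borel_measurable borel"
  by (simp add: exp_growth_def)

lemma exp_growth_dominated:
  assumes "exp_growth v" "u \<in> borel_measurable borel" "\<And>x. \<bar>u x\<bar> \<le> \<bar>v x\<bar>"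
  shows "exp_growth u"
  using assms unfolding exp_growth_def by (meson order_trans)

lemma exp_growth_const [intro, simp]: "exp_growth (\<lambda>_. c)"
  by (rule exp_growthI[where K="\<bar>c\<bar>" and a=0]) auto

lemma exp_growth_mult [intro]:
  fixes u v :: "'a::euclidean_space \<Rightarrow> real"
  assumes u: "exp_growth u" and v: "exp_growth v"
  shows "exp_growth (\<lambda>x. u x * v x)"
proof -
  obtain K a where *: "0 \<le> K" "0 \<le> a" "\<And>x. \<bar>u x\<bar> \<le> K * exp (a * norm x)"
    using u unfolding exp_growth_def by blast
  obtain K' a' where **: "0 \<le> K'" "0 \<le> a'" "\<And>x. \<bar>v x\<bar> \<le> K' * exp (a' * norm x)"
    using v unfolding exp_growth_def by blast
  show ?thesis
  proof (rule exp_growthI[where K="K * K'" and a="a + a'"])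
    fix x
    have "\<bar>u x * v x\<bar> \<le> (K * exp (a * norm x)) * (K' * exp (a' * norm x))"
      unfolding abs_mult using * ** by (intro mult_mono) auto
    then show "\<bar>u x * v x\<bar> \<le> K * K' * exp ((a + a') * norm x)"
      by (simp add: distrib_right exp_add mult.assoc mult.left_commute)
  qed (use * ** u v in \<open>auto simp: exp_growth_def\<close>)
qed

lemma exp_growth_add [intro]:
  fixes u v :: "'a::euclidean_space \<Rightarrow> real"
  assumes u: "exp_growth u" and v: "exp_growth v"
  shows "exp_growth (\<lambda>x. u x + v x)"
proof -
  obtain K a where *: "0 \<le> K" "0 \<le> a" "\<And>x. \<bar>u x\<bar> \<le> K * exp (a * norm x)"
    using u unfolding exp_growth_def by blast
  obtain K' a' where **: "0 \<le> K'" "0 \<le> a'" "\<And>x. \<bar>v x\<bar> \<le> K' * exp (a' * norm x)"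
    using v unfolding exp_growth_def by blast
  show ?thesis
  proof (rule exp_growthI[where K="K + K'" and a="a + a'"])
    fix x :: 'a
    have "K * exp (a * norm x) \<le> K * exp ((a + a') * norm x)"
        "K' * exp (a' * norm x) \<le> K' * exp ((a + a') * norm x)"
      using * ** by (auto intro!: mult_left_mono mult_right_mono)
    then show "\<bar>u x + v x\<bar> \<le> (K + K') * exp ((a + a') * norm x)"
      using *(3)[of x] **(3)[of x] by (simp add: distrib_right)
  qed (use * ** u v in \<open>auto simp: exp_growth_def\<close>)
qed

lemma exp_growth_diff [intro]:
  assumes "exp_growth u" "exp_growth v"
  shows "exp_growth (\<lambda>x. u x - v x)"
  using exp_growth_add[OF assms(1) exp_growth_mult[OF exp_growth_const[of "-1"] assms(2)]] by simp

lemma exp_growth_power [intro]: "exp_growth u \<Longrightarrow> exp_growth (\<lambda>x. u x ^ n)"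
  by (induction n) auto

lemma lipschitz_abs_le:
  fixes g :: "'a::euclidean_space \<Rightarrow> real"
  assumes "L-lipschitz_on UNIV g"
  shows "\<bar>g x - g y\<bar> \<le> L * norm (x - y)"
  using lipschitz_onD[OF assms, of x y] by (simp add: dist_norm)

lemma lipschitz_measurable:
  fixes g :: "'a::euclidean_space \<Rightarrow> real"
  assumes "L-lipschitz_on UNIV g"
  shows "g \<in> borel_measurable borel"
  using lipschitz_on_continuous_on[OF assms] by (rule borel_measurable_continuous_onI)

lemma exp_growth_exp_lipschitz:
  assumes g: "L-lipschitz_on UNIV g"
  shows "exp_growth (\<lambda>x. exp (t * g x))"
proof (rule exp_growthI[where K="exp (\<bar>t * g 0\<bar>)" and a="\<bar>t\<bar> * L"])
  fix x
  have "t * g x = t * (g x - g 0) + t * g 0"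
    by (simp add: algebra_simps)
  also have "\<dots> \<le> \<bar>t\<bar> * (L * norm x) + \<bar>t * g 0\<bar>"
  proof (rule add_mono)
    have "t * (g x - g 0) \<le> \<bar>t\<bar> * \<bar>g x - g 0\<bar>"
      by (metis abs_ge_self abs_mult)
    also have "\<dots> \<le> \<bar>t\<bar> * (L * norm x)"
      using lipschitz_abs_le[OF g, of x 0] by (intro mult_left_mono) auto
    finally show "t * (g x - g 0) \<le> \<bar>t\<bar> * (L * norm x)" .
  qed simp
  finally show "\<bar>exp (t * g x)\<bar> \<le> exp (\<bar>t * g 0\<bar>) * exp (\<bar>t\<bar> * L * norm x)"
    by (simp add: exp_add[symmetric] ac_simps)
qed (use lipschitz_on_nonneg[OF g] lipschitz_measurable[OF g] in auto)

lemma exp_growth_lipschitz: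
  assumes g: "L-lipschitz_on UNIV g"
  shows "exp_growth g"
proof (rule exp_growth_dominated)
  show "exp_growth (\<lambda>x. exp (1 * g x) + exp (- 1 * g x))"
    by (intro exp_growth_add exp_growth_exp_lipschitz[OF g])
  show "\<bar>g x\<bar> \<le> \<bar>exp (1 * g x) + exp (- 1 * g x)\<bar>" for x
  proof -
    have "\<bar>g x\<bar> \<le> exp (g x) + exp (- g x)"
      using exp_ge_add_one_self[of "g x"] exp_ge_add_one_self[of "- g x"] exp_gt_zero[of "g x"]
        exp_gt_zero[of "- g x"] by linarith
    then show ?thesis by simp
  qed
qed (rule lipschitz_measurable[OF g])

lemma lipschitz_inner: "(norm v)-lipschitz_on UNIV (\<lambda>x. x \<bullet> v)"
  by (rule lipschitz_onI)
     (auto simp: dist_norm inner_diff_left[symmetric] mult.commute intro: order_trans[OF Cauchy_Schwarz_ineq2])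

lemma exp_growth_inner [intro]: "exp_growth (\<lambda>x. x \<bullet> v)"
  by (rule exp_growth_lipschitz[OF lipschitz_inner])

definition has_exp_moments :: "'a::euclidean_space measure \<Rightarrow> bool" where
  "has_exp_moments \<mu> \<longleftrightarrow> sets \<mu> = sets borel \<and> (\<forall>a. integrable \<mu> (\<lambda>x. exp (a * norm x)))"

lemma integrable_exp_growth:
  assumes "has_exp_moments \<mu>" "exp_growth u"
  shows "integrable \<mu> u"
proof -
  obtain K a where *: "0 \<le> K" "0 \<le> a" "\<And>x. \<bar>u x\<bar> \<le> K * exp (a * norm x)"
    using assms(2) unfolding exp_growth_def by blast
  show ?thesis
  proof (rule Bochner_Integration.integrable_bound)
    show "integrable \<mu> (\<lambda>x. K * exp (a * norm x))"
      using assms by (simp add: has_exp_moments_def)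
    show "u \<in> borel_measurable \<mu>"
      using assms by (simp add: has_exp_moments_def exp_growth_def cong: measurable_cong_sets)
    show "AE x in \<mu>. norm (u x) \<le> norm (K * exp (a * norm x))"
      using * by (intro AE_I2) (auto simp: abs_mult)
  qed
qed

section \<open>The Poincare inequality for uniformly log-concave densities\<close>

lemma exp_ge_cubic: "1 + u + u\<^sup>2 / 2 + u ^ 3 / 6 \<le> exp (u :: real)"
proof -
  obtain t where "exp u = (\<Sum>m<4. u ^ m / fact m) + exp t / fact 4 * u ^ 4"
    using Maclaurin_exp_le by blast
  moreover have "0 \<le> exp t / fact 4 * u ^ 4"
    by simp
  ultimately show ?thesis
    by (simp add: eval_nat_numeral)
qed

text \<open>This is \<open>(Q y - e * g y) / e^2\<close>, where \<open>Q y = (INF x. e * g x + \<kappa> / 4 * |x - y|^2)\<close> is the quadratic infimum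
  convolution of \<open>e * g\<close>, written in the variable \<open>v = (x - y) / e\<close>. In this scaling it is bounded uniformly
  in \<open>e\<close> and converges as \<open>e\<close> tends to \<open>0\<close>.\<close>

definition inf_conv_slope :: "real \<Rightarrow> ('a::euclidean_space \<Rightarrow> real) \<Rightarrow> real \<Rightarrow> 'a \<Rightarrow> real" where
  "inf_conv_slope \<kappa> g e y = (INF v. (g (y + e *\<^sub>R v) - g y) / e + \<kappa> / 4 * (norm v)\<^sup>2)"

lemma quadratic_lower_bound:
  fixes \<kappa> l s :: real
  assumes "0 < \<kappa>"
  shows "- (l\<^sup>2 / \<kappa>) \<le> - (l * s) + \<kappa> / 4 * s\<^sup>2"
proof -
  have "0 \<le> (\<kappa> * s - 2 * l)\<^sup>2 / (4 * \<kappa>)"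
    using assms by simp
  also have "\<dots> = - (l * s) + \<kappa> / 4 * s\<^sup>2 + l\<^sup>2 / \<kappa>"
    using assms by (simp add: power2_eq_square field_simps)
  finally show ?thesis by simp
qed

context
  fixes \<kappa> L e :: real and g :: "'a::euclidean_space \<Rightarrow> real"
  assumes \<kappa>: "0 < \<kappa>" and g: "L-lipschitz_on UNIV g" and e: "0 < e"
begin

lemma difference_quotient_ge: "- (L * norm v) \<le> (g (y + e *\<^sub>R v) - g y) / e"
proof -
  have "- (e * (L * norm v)) \<le> g (y + e *\<^sub>R v) - g y"
    using lipschitz_abs_le[OF g, of "y + e *\<^sub>R v" y] e by (simp add: ac_simps)
  then show ?thesis
    using e by (simp add: field_simps)
qed

lemma inf_conv_slope_integrand_ge: "- (L\<^sup>2 / \<kappa>) \<le> (g (y + e *\<^sub>R v) - g y) / e + \<kappa> / 4 * (norm v)\<^sup>2"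
  using difference_quotient_ge[of v y] quadratic_lower_bound[OF \<kappa>, of L "norm v"] by linarith

lemma inf_conv_slope_bdd: "bdd_below (range (\<lambda>v. (g (y + e *\<^sub>R v) - g y) / e + \<kappa> / 4 * (norm v)\<^sup>2))"
  by (rule bdd_belowI2) (rule inf_conv_slope_integrand_ge)

lemma inf_conv_slope_le: "inf_conv_slope \<kappa> g e y \<le> (g (y + e *\<^sub>R v) - g y) / e + \<kappa> / 4 * (norm v)\<^sup>2"
  unfolding inf_conv_slope_def by (rule cINF_lower[OF inf_conv_slope_bdd]) simp

lemma inf_conv_slope_ge: "- (L\<^sup>2 / \<kappa>) \<le> inf_conv_slope \<kappa> g e y"
  unfolding inf_conv_slope_def by (rule cINF_greatest) (simp, rule inf_conv_slope_integrand_ge)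

lemma inf_conv_slope_nonpos: "inf_conv_slope \<kappa> g e y \<le> 0"
  using inf_conv_slope_le[of y 0] by simp

text \<open>An infimum of continuous functions is upper semicontinuous, even over an uncountable index set.\<close>

lemma inf_conv_slope_measurable [measurable]: "inf_conv_slope \<kappa> g e \<in> borel_measurable borel"
proof (rule borel_measurable_iff_less[THEN iffD2], rule allI)
  fix a
  let ?u = "\<lambda>v y. (g (y + e *\<^sub>R v) - g y) / e + \<kappa> / 4 * (norm v)\<^sup>2"
  have cont: "continuous_on UNIV g"
    by (rule lipschitz_on_continuous_on[OF g])
  have "{y. inf_conv_slope \<kappa> g e y < a} = (\<Union>v. {y. ?u v y < a})"
  proof (rule set_eqI)
    show "y \<in> {y. inf_conv_slope \<kappa> g e y < a} \<longleftrightarrow> y \<in> (\<Union>v. {y. ?u v y < a})" for y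
      using cINF_less_iff[OF UNIV_not_empty inf_conv_slope_bdd, of y a]
      unfolding inf_conv_slope_def by blast
  qed
  moreover have "open {y. ?u v y < a}" for v
    by (intro open_Collect_less continuous_intros continuous_on_compose2[OF cont]) (use e in auto)
  ultimately show "{w \<in> space borel. inf_conv_slope \<kappa> g e w < a} \<in> sets borel"
    by (simp add: borel_open open_UN)
qed

end

text \<open>On the ball of radius \<open>W\<close> the difference quotient is uniformly close to \<open>v \<bullet> D\<close>, and minimizing
  \<open>v \<bullet> D + \<kappa> / 4 * |v|^2\<close> gives \<open>- |D|^2 / \<kappa>\<close>, attained at \<open>v = - (2 / \<kappa>) *\<^sub>R D\<close>. Outside the ball the quadratic
  term dominates the Lipschitz bound, so such \<open>v\<close> do not lower the infimum. The radius \<open>W\<close> is large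
  enough for the minimizer to lie inside and for the domination to hold outside.\<close>

lemma inf_conv_slope_tendsto:
  fixes g :: "'a::euclidean_space \<Rightarrow> real"
  assumes \<kappa>: "0 < \<kappa>" and g: "L-lipschitz_on UNIV g" and D: "GDERIV g y :> D"
  shows "((\<lambda>e. inf_conv_slope \<kappa> g e y) \<longlongrightarrow> - ((norm D)\<^sup>2 / \<kappa>)) (at_right 0)"
proof (rule tendstoI)
  fix e :: real assume "0 < e"
  have L: "0 \<le> L"
    by (rule lipschitz_on_nonneg[OF g])
  \<comment> \<open>\<open>4 * L / \<kappa>\<close> serves the points outside the ball, \<open>2 * norm D / \<kappa>\<close> is the norm of the minimizer, and \<open>1\<close> makes \<open>W\<close> positive.\<close>
  define W where "W = 4 * L / \<kappa> + 2 * norm D / \<kappa> + 1"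
  have W: "0 < W"
    using L \<kappa> by (auto simp: W_def intro!: add_nonneg_pos)
  define \<eta> where "\<eta> = e / (2 * W)"
  have \<eta>: "0 < \<eta>"
    using \<open>0 < e\<close> W by (simp add: \<eta>_def)
  obtain d where d: "0 < d" "\<And>h. norm h < d \<Longrightarrow> \<bar>g (y + h) - g y - h \<bullet> D\<bar> \<le> \<eta> * norm h"
  proof -
    have "(g has_derivative (\<lambda>h. h \<bullet> D)) (at y)"
      using D by (simp add: gderiv_def)
    then obtain d where "0 < d" "\<And>z. norm (z - y) < d \<Longrightarrow> norm (g z - g y - (z - y) \<bullet> D) \<le> \<eta> * norm (z - y)"
      unfolding has_derivative_at_alt using \<eta> by blast
    from this(1) this(2)[of "y + _"] show ?thesis
      by (intro that[of d]) auto
  qed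
  have "\<forall>\<^sub>F s in at_right 0. s \<in> {0<..<d / W}"
    using W d(1) by (intro eventually_at_right_real) simp
  then show "\<forall>\<^sub>F s in at_right 0. dist (inf_conv_slope \<kappa> g s y) (- ((norm D)\<^sup>2 / \<kappa>)) < e"
  proof (rule eventually_mono)
    fix s assume "s \<in> {0<..<d / W}"
    then have s: "0 < s" "s * W < d"
      using W by (auto simp: field_simps)
    have quot: "\<bar>(g (y + s *\<^sub>R v) - g y) / s - v \<bullet> D\<bar> \<le> e / 2" if v: "norm v \<le> W" for v
    proof -
      have "s * norm v \<le> s * W"
        using s v by simp
      then have "s * norm v < d"
        using s(2) by linarith
      then have "\<bar>g (y + s *\<^sub>R v) - g y - s * (v \<bullet> D)\<bar> \<le> \<eta> * (s * norm v)"
        using d(2)[of "s *\<^sub>R v"] s by simp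
      also have "\<dots> \<le> s * (e / 2)"
        using v s \<open>0 < e\<close> W mult_left_mono[of "norm v" W "s * e"] by (simp add: \<eta>_def field_simps)
      finally have "\<bar>(g (y + s *\<^sub>R v) - g y - s * (v \<bullet> D)) / s\<bar> \<le> e / 2"
        using s by (simp add: abs_divide field_simps)
      then show ?thesis
        using s by (simp add: diff_divide_distrib)
    qed
    have "- ((norm D)\<^sup>2 / \<kappa>) - e / 2 \<le> inf_conv_slope \<kappa> g s y"
      unfolding inf_conv_slope_def
    proof (rule cINF_greatest)
      fix v
      show "- ((norm D)\<^sup>2 / \<kappa>) - e / 2 \<le> (g (y + s *\<^sub>R v) - g y) / s + \<kappa> / 4 * (norm v)\<^sup>2"
      proof (cases "norm v \<le> W")
        case True
        have "- (norm D * norm v) \<le> v \<bullet> D"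
          using Cauchy_Schwarz_ineq2[of v D] by (simp add: mult.commute abs_le_iff)
        then show ?thesis
          using quot[OF True] quadratic_lower_bound[OF \<kappa>, of "norm D" "norm v"] by linarith
      next
        case False
        moreover have "0 \<le> 2 * norm D / \<kappa>"
          using \<kappa> by simp
        ultimately have "4 * L / \<kappa> \<le> norm v"
          unfolding W_def by linarith
        then have "L \<le> \<kappa> / 4 * norm v"
          using \<kappa> by (simp add: field_simps)
        then have "L * norm v \<le> \<kappa> / 4 * (norm v)\<^sup>2"
          using mult_right_mono[of L "\<kappa> / 4 * norm v" "norm v"] by (simp add: power2_eq_square ac_simps)
        moreover have "0 \<le> (norm D)\<^sup>2 / \<kappa>"
          using \<kappa> by simp
        ultimately show ?thesis
          using difference_quotient_ge[OF \<kappa> g s(1), of v y] \<open>0 < e\<close> by linarith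
      qed
    qed simp
    moreover have "inf_conv_slope \<kappa> g s y \<le> - ((norm D)\<^sup>2 / \<kappa>) + e / 2"
    proof -
      let ?v = "(- 2 / \<kappa>) *\<^sub>R D"
      have nv: "norm ?v \<le> W"
        using \<kappa> L by (simp add: W_def)
      have "?v \<bullet> D + \<kappa> / 4 * (norm ?v)\<^sup>2 = - ((norm D)\<^sup>2 / \<kappa>)"
        using \<kappa> by (simp add: dot_square_norm power_mult_distrib field_simps power2_eq_square)
      then show ?thesis
        using quot[OF nv] inf_conv_slope_le[OF \<kappa> g s(1), of y ?v] by linarith
    qed
    ultimately show "dist (inf_conv_slope \<kappa> g s y) (- ((norm D)\<^sup>2 / \<kappa>)) < e"
      using \<open>0 < e\<close> by (simp add: dist_real_def abs_less_iff)
  qed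
qed

text \<open>Maurey's property: apply Prekopa-Leindler to \<open>\<rho> * exp (- e * g)\<close>, \<open>\<rho> * exp Q\<close> and \<open>\<rho>\<close>, where \<open>Q\<close> is the infimum
  convolution of \<open>e * g\<close>. The gain \<open>exp (\<kappa> / 4 * |x - y|^2)\<close> from uniform log-concavity pays for
  \<open>Q y - e * g x \<le> \<kappa> / 4 * |x - y|^2\<close>, which holds by the definition of \<open>Q\<close>.\<close>

lemma uniformly_log_concave_infimum_convolution:
  fixes \<rho> g :: "'a::euclidean_space \<Rightarrow> real"
  assumes \<kappa>: "0 < \<kappa>" and [measurable]: "\<rho> \<in> borel_measurable borel" and nonneg: "\<And>x. 0 \<le> \<rho> x"
    and prob: "prob_space (density lborel \<rho>)"
    and concave: "\<And>x y. \<rho> x * \<rho> y * exp (\<kappa> / 4 * (norm (x - y))\<^sup>2) \<le> (\<rho> ((x + y) /\<^sub>R 2))\<^sup>2"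
    and g: "L-lipschitz_on UNIV g" and e: "0 < e"
  shows "(\<integral>\<^sup>+x. ennreal (exp (- (e * g x))) \<partial>density lborel \<rho>)
    * (\<integral>\<^sup>+x. ennreal (exp (e * g x + e\<^sup>2 * inf_conv_slope \<kappa> g e x)) \<partial>density lborel \<rho>) \<le> 1"
proof -
  note [measurable] = lipschitz_measurable[OF g] inf_conv_slope_measurable[OF \<kappa> g e]
  let ?Q = "\<lambda>x. e * g x + e\<^sup>2 * inf_conv_slope \<kappa> g e x"
  have "(\<integral>\<^sup>+x. ennreal (\<rho> x * exp (- (e * g x))) \<partial>lborel) * (\<integral>\<^sup>+x. ennreal (\<rho> x * exp (?Q x)) \<partial>lborel)
      \<le> (\<integral>\<^sup>+x. ennreal (\<rho> x) \<partial>lborel)\<^sup>2"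
  proof (rule prekopa_leindler)
    fix x y :: 'a
    \<comment> \<open>The competitor in the infimum that moves \<open>y\<close> to \<open>x\<close>.\<close>
    let ?v = "(x - y) /\<^sub>R e"
    have "inf_conv_slope \<kappa> g e y \<le> (g x - g y) / e + \<kappa> / 4 * (norm ?v)\<^sup>2"
      using inf_conv_slope_le[OF \<kappa> g e, of y ?v] e by simp
    then have "e\<^sup>2 * inf_conv_slope \<kappa> g e y \<le> e\<^sup>2 * ((g x - g y) / e + \<kappa> / 4 * (norm ?v)\<^sup>2)"
      by (intro mult_left_mono) auto
    also have "norm ?v = norm (x - y) / e"
      using e by (simp add: divide_inverse_commute)
    also have "e\<^sup>2 * ((g x - g y) / e + \<kappa> / 4 * (norm (x - y) / e)\<^sup>2) = e * (g x - g y) + \<kappa> / 4 * (norm (x - y))\<^sup>2"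
      using e by (simp add: power_mult_distrib power2_eq_square field_simps)
    finally have "- (e * g x) + ?Q y \<le> \<kappa> / 4 * (norm (x - y))\<^sup>2"
      by (simp add: algebra_simps)
    then have "\<rho> x * \<rho> y * exp (- (e * g x) + ?Q y) \<le> \<rho> x * \<rho> y * exp (\<kappa> / 4 * (norm (x - y))\<^sup>2)"
      using nonneg by (intro mult_left_mono) auto
    also note concave
    also have "\<rho> x * \<rho> y * exp (- (e * g x) + ?Q y) = \<rho> x * exp (- (e * g x)) * (\<rho> y * exp (?Q y))"
      by (subst exp_add) (simp only: ac_simps)
    finally have "\<rho> x * exp (- (e * g x)) * (\<rho> y * exp (?Q y)) \<le> (\<rho> ((x + y) /\<^sub>R 2))\<^sup>2" .
    then show "ennreal (\<rho> x * exp (- (e * g x))) * ennreal (\<rho> y * exp (?Q y)) \<le> (ennreal (\<rho> ((x + y) /\<^sub>R 2)))\<^sup>2"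
      using nonneg by (simp add: ennreal_mult[symmetric] ennreal_power ennreal_leI)
  qed measurable
  moreover have "(\<integral>\<^sup>+x. ennreal (\<rho> x) \<partial>lborel) = 1"
    using prob_space.emeasure_space_1[OF prob] by (simp add: emeasure_density)
  ultimately show ?thesis
    using nonneg by (simp add: nn_integral_density ennreal_mult)
qed

lemma inverse_Suc_at_right: "filterlim (\<lambda>n. inverse (real (Suc n))) (at_right 0) sequentially"
  unfolding filterlim_at using LIMSEQ_inverse_real_of_nat by (auto simp del: of_nat_Suc)

text \<open>The squared gradient norm is a pointwise limit of the measurable functions \<open>- inf_conv_slope 1 g e\<close>.\<close>

lemma GDERIV_norm_measurable:
  fixes g :: "'a::euclidean_space \<Rightarrow> real"
  assumes g: "L-lipschitz_on UNIV g" and D: "\<And>x. GDERIV g x :> D x"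
  shows "(\<lambda>x. (norm (D x))\<^sup>2) \<in> borel_measurable borel"
proof -
  have "(\<lambda>x. - ((norm (D x))\<^sup>2 / 1)) \<in> borel_measurable borel"
  proof (rule borel_measurable_LIMSEQ_real)
    show "(\<lambda>n. inf_conv_slope 1 g (inverse (real (Suc n))) x) \<longlonglongrightarrow> - ((norm (D x))\<^sup>2 / 1)" for x
      by (rule filterlim_compose[OF inf_conv_slope_tendsto[OF _ g D]])
         (auto simp: inverse_Suc_at_right simp del: of_nat_Suc)
    show "inf_conv_slope 1 g (inverse (real (Suc n))) \<in> borel_measurable borel" for n
      by (rule inf_conv_slope_measurable[OF _ g]) auto
  qed
  then have "(\<lambda>x. - (- ((norm (D x))\<^sup>2 / 1))) \<in> borel_measurable borel"
    by (rule borel_measurable_uminus)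
  then show ?thesis by simp
qed

text \<open>The approximations \<open>inf_conv_slope 1 g e\<close> of \<open>- |D|^2\<close> are all at least \<open>- L^2\<close>.\<close>

lemma GDERIV_norm_le:
  fixes g :: "'a::euclidean_space \<Rightarrow> real"
  assumes g: "L-lipschitz_on UNIV g" and D: "GDERIV g x :> D"
  shows "(norm D)\<^sup>2 \<le> L\<^sup>2"
proof -
  have "- (L\<^sup>2 / 1) \<le> - ((norm D)\<^sup>2 / 1)"
    by (rule tendsto_lowerbound[OF inf_conv_slope_tendsto[OF _ g D]])
       (auto intro!: eventually_at_rightI[of 0 1] inf_conv_slope_ge[OF _ g, of 1, simplified])
  then show ?thesis by simp
qed

lemma integral_le_nn_integral_of_le:
  assumes "integrable M u" "u' \<in> borel_measurable M" "\<And>x. u x \<le> u' x" "\<And>x. 0 \<le> u' x"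
  shows "ennreal (\<integral>x. u x \<partial>M) \<le> (\<integral>\<^sup>+x. ennreal (u' x) \<partial>M)"
proof -
  have "ennreal (\<integral>x. u x \<partial>M) \<le> ennreal (\<integral>x. max 0 (u x) \<partial>M)"
    using assms(1) by (intro ennreal_leI integral_mono) auto
  also have "\<dots> = (\<integral>\<^sup>+x. ennreal (max 0 (u x)) \<partial>M)"
    using assms(1) by (intro nn_integral_eq_integral[symmetric]) auto
  also have "\<dots> \<le> (\<integral>\<^sup>+x. ennreal (u' x) \<partial>M)"
    using assms(3,4) by (intro nn_integral_mono ennreal_leI) auto
  finally show ?thesis .
qed

text \<open>Let \<open>G\<close> be the centred version of \<open>g\<close>, and let \<open>2 * s\<close>, \<open>6 * \<tau>\<close> be its second and third moments. Cubic
  lower bounds for the exponential show that the two integrals of Maurey's property are at least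
  \<open>X = 1 + e^2 * (s - e * \<tau>)\<close> and \<open>Y = 1 + e^2 * (s + e * \<tau> + r)\<close>, where \<open>r\<close> tends to \<open>- q\<close> and \<open>q\<close> is the right-hand
  side of the claim. From \<open>X * Y \<le> 1\<close>, dividing by \<open>e^2\<close> and letting \<open>e\<close> tend to \<open>0\<close>, one gets \<open>2 * s \<le> q\<close>.\<close>

theorem poincare_uniformly_log_concave:
  fixes \<rho> g :: "'a::euclidean_space \<Rightarrow> real"
  defines "\<mu> \<equiv> density lborel \<rho>"
  assumes \<kappa>: "0 < \<kappa>" and \<rho>: "\<rho> \<in> borel_measurable borel" and nonneg: "\<And>x. 0 \<le> \<rho> x"
    and prob: "prob_space \<mu>" and moments: "has_exp_moments \<mu>"
    and concave: "\<And>x y. \<rho> x * \<rho> y * exp (\<kappa> / 4 * (norm (x - y))\<^sup>2) \<le> (\<rho> ((x + y) /\<^sub>R 2))\<^sup>2"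
    and g: "L-lipschitz_on UNIV g" and D: "\<And>x. GDERIV g x :> D x"
  shows "(\<integral>x. (g x - (\<integral>y. g y \<partial>\<mu>))\<^sup>2 \<partial>\<mu>) \<le> (\<integral>x. (norm (D x))\<^sup>2 \<partial>\<mu>) / \<kappa>"
proof -
  interpret prob_space \<mu> by (rule prob)
  define m where "m = (\<integral>y. g y \<partial>\<mu>)"
  define G where "G x = g x - m" for x
  have G: "L-lipschitz_on UNIV G"
    using g by (auto simp: lipschitz_on_def G_def dist_real_def)
  have DG: "GDERIV G x :> D x" for x
    using D[of x] unfolding gderiv_def G_def by (auto intro!: derivative_eq_intros)
  note growth = exp_growth_lipschitz[OF G]
  have int: "integrable \<mu> u" if "exp_growth u" for u
    using integrable_exp_growth[OF moments that] .
  have sets: "sets \<mu> = sets borel"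
    by (simp add: \<mu>_def)
  have meas: "u \<in> borel_measurable borel \<Longrightarrow> u \<in> borel_measurable \<mu>" for u :: "'a \<Rightarrow> real"
    by (simp add: cong: measurable_cong_sets[OF sets refl])
  have G0: "(\<integral>x. G x \<partial>\<mu>) = 0"
    using int[OF exp_growth_lipschitz[OF g]] by (simp add: G_def m_def prob_space)
  define s where "s = (\<integral>x. (G x)\<^sup>2 \<partial>\<mu>) / 2"
  define \<tau> where "\<tau> = (\<integral>x. G x ^ 3 \<partial>\<mu>) / 6"
  define q where "q = (\<integral>x. (norm (D x))\<^sup>2 \<partial>\<mu>) / \<kappa>"
  define e where "e n = inverse (real (Suc n))" for n
  have e: "0 < e n" "e n \<le> 1" for n
    by (auto simp: e_def inverse_eq_divide)
  have e_lim: "e \<longlonglongrightarrow> 0"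
    unfolding e_def by (rule LIMSEQ_inverse_real_of_nat)
  define R where "R n = inf_conv_slope \<kappa> G (e n)" for n
  define r where "r n = (\<integral>x. R n x * exp (e n * G x) \<partial>\<mu>)" for n
  have Rm: "R n \<in> borel_measurable borel" for n
    unfolding R_def by (rule inf_conv_slope_measurable[OF \<kappa> G e(1)])
  have R_bound: "\<bar>R n x\<bar> \<le> L\<^sup>2 / \<kappa>" for n x
    using inf_conv_slope_ge[OF \<kappa> G e(1), of n x] inf_conv_slope_nonpos[OF \<kappa> G e(1), of n x]
    by (auto simp: R_def)
  have R_growth: "exp_growth (R n)" for n
    using R_bound[of n] by (intro exp_growthI[OF Rm, where K="L\<^sup>2 / \<kappa>" and a=0]) (auto simp: \<kappa> less_imp_le)
  note eG = exp_growth_exp_lipschitz[OF G]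
  have r_lim: "r \<longlonglongrightarrow> (\<integral>x. - ((norm (D x))\<^sup>2 / \<kappa>) * exp (0 * G x) \<partial>\<mu>)"
    unfolding r_def
  proof (rule integral_dominated_convergence[where w="\<lambda>x. L\<^sup>2 / \<kappa> * (exp (1 * G x) + exp (- 1 * G x))"])
    show "integrable \<mu> (\<lambda>x. L\<^sup>2 / \<kappa> * (exp (1 * G x) + exp (- 1 * G x)))"
      by (intro int exp_growth_mult exp_growth_add eG exp_growth_const)
    show "(\<lambda>x. - ((norm (D x))\<^sup>2 / \<kappa>) * exp (0 * G x)) \<in> borel_measurable \<mu>"
      using GDERIV_norm_measurable[OF g D] by (intro meas) simp
    show "(\<lambda>x. R n x * exp (e n * G x)) \<in> borel_measurable \<mu>" for n
      by (intro meas exp_growth_measurable exp_growth_mult R_growth eG)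
    show "AE x in \<mu>. (\<lambda>n. R n x * exp (e n * G x)) \<longlonglongrightarrow> - ((norm (D x))\<^sup>2 / \<kappa>) * exp (0 * G x)"
    proof (intro AE_I2 tendsto_intros e_lim)
      show "(\<lambda>n. R n x) \<longlonglongrightarrow> - ((norm (D x))\<^sup>2 / \<kappa>)" for x
        unfolding R_def e_def
        by (rule filterlim_compose[OF inf_conv_slope_tendsto[OF \<kappa> G DG] inverse_Suc_at_right])
    qed
    show "AE x in \<mu>. norm (R n x * exp (e n * G x)) \<le> L\<^sup>2 / \<kappa> * (exp (1 * G x) + exp (- 1 * G x))" for n
    proof (intro AE_I2)
      fix x
      have "e n * G x \<le> e n * \<bar>G x\<bar>"
        using e(1)[of n] by (intro mult_left_mono) auto
      also have "\<dots> \<le> \<bar>G x\<bar>"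
        using e(2)[of n] by (simp add: mult_left_le_one_le e(1) less_imp_le)
      finally have "e n * G x \<le> \<bar>G x\<bar>" .
      then have "exp (e n * G x) \<le> exp \<bar>G x\<bar>"
        by simp
      also have "\<dots> \<le> exp (1 * G x) + exp (- 1 * G x)"
        by (auto simp: abs_if)
      finally have "\<bar>R n x\<bar> * exp (e n * G x) \<le> L\<^sup>2 / \<kappa> * (exp (1 * G x) + exp (- 1 * G x))"
        using R_bound[of n x] \<kappa> by (intro mult_mono) auto
      then show "norm (R n x * exp (e n * G x)) \<le> L\<^sup>2 / \<kappa> * (exp (1 * G x) + exp (- 1 * G x))"
        by (simp add: abs_mult)
    qed
  qed
  then have r_lim_q: "r \<longlonglongrightarrow> - q"
    by (simp add: q_def)
  define X where "X n = 1 + (e n)\<^sup>2 * (s - e n * \<tau>)" for n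
  define Y where "Y n = 1 + (e n)\<^sup>2 * (s + e n * \<tau> + r n)" for n
  have X_lim: "X \<longlonglongrightarrow> 1 + 0\<^sup>2 * (s - 0 * \<tau>)"
    unfolding X_def by (intro tendsto_intros e_lim)
  have Y_lim: "Y \<longlonglongrightarrow> 1 + 0\<^sup>2 * (s + 0 * \<tau> + (- q))"
    unfolding Y_def by (intro tendsto_intros e_lim r_lim_q)
  \<comment> \<open>Stated in \<^typ>\<open>ennreal\<close>, where negative values are truncated to \<open>0\<close>: \<open>X n\<close> and \<open>Y n\<close> are positive only for large \<open>n\<close>.\<close>
  have XY: "ennreal (X n) * ennreal (Y n) \<le> 1" for n
  proof -
    let ?e = "e n"
    have X_eq: "X n = (\<integral>x. 1 + - ?e * G x + ?e\<^sup>2 / 2 * (G x)\<^sup>2 + - (?e ^ 3 / 6) * G x ^ 3 \<partial>\<mu>)"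
      by (subst Bochner_Integration.integral_add, (intro int exp_growth_add exp_growth_mult exp_growth_power exp_growth_const growth)+)+
         (simp add: X_def s_def \<tau>_def G0 prob_space, simp add: field_simps power2_eq_square power3_eq_cube)
    have X: "ennreal (X n) \<le> (\<integral>\<^sup>+x. ennreal (exp (- (?e * G x))) \<partial>\<mu>)"
      unfolding X_eq
    proof (rule integral_le_nn_integral_of_le)
      show "1 + - ?e * G x + ?e\<^sup>2 / 2 * (G x)\<^sup>2 + - (?e ^ 3 / 6) * G x ^ 3 \<le> exp (- (?e * G x))" for x
        using exp_ge_cubic[of "- (?e * G x)"] by (simp add: power_mult_distrib)
    next
      show "(\<lambda>x. exp (- (?e * G x))) \<in> borel_measurable \<mu>"
        using lipschitz_measurable[OF G] by (intro meas) measurable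
      show "integrable \<mu> (\<lambda>x. 1 + - ?e * G x + ?e\<^sup>2 / 2 * (G x)\<^sup>2 + - (?e ^ 3 / 6) * G x ^ 3)"
        by (intro int exp_growth_add exp_growth_mult exp_growth_power exp_growth_const growth)
    qed simp
    have Y_eq: "Y n = (\<integral>x. 1 + ?e * G x + ?e\<^sup>2 / 2 * (G x)\<^sup>2 + ?e ^ 3 / 6 * G x ^ 3 + ?e\<^sup>2 * (R n x * exp (?e * G x)) \<partial>\<mu>)"
      by (subst Bochner_Integration.integral_add, (intro int exp_growth_add exp_growth_mult exp_growth_power exp_growth_const growth R_growth eG)+)+
         (simp add: Y_def s_def \<tau>_def r_def G0 prob_space, simp add: field_simps power2_eq_square power3_eq_cube)
    have Y: "ennreal (Y n) \<le> (\<integral>\<^sup>+x. ennreal (exp (?e * G x + ?e\<^sup>2 * R n x)) \<partial>\<mu>)"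
      unfolding Y_eq
    proof (rule integral_le_nn_integral_of_le)
      fix x
      have "1 + ?e * G x + ?e\<^sup>2 / 2 * (G x)\<^sup>2 + ?e ^ 3 / 6 * G x ^ 3 \<le> exp (?e * G x)"
        using exp_ge_cubic[of "?e * G x"] by (simp add: power_mult_distrib)
      moreover have "exp (?e * G x) * (1 + ?e\<^sup>2 * R n x) \<le> exp (?e * G x) * exp (?e\<^sup>2 * R n x)"
        by (intro mult_left_mono exp_ge_add_one_self) simp
      ultimately show "1 + ?e * G x + ?e\<^sup>2 / 2 * (G x)\<^sup>2 + ?e ^ 3 / 6 * G x ^ 3 + ?e\<^sup>2 * (R n x * exp (?e * G x))
          \<le> exp (?e * G x + ?e\<^sup>2 * R n x)"
        by (simp add: exp_add algebra_simps)
    next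
      show "(\<lambda>x. exp (?e * G x + ?e\<^sup>2 * R n x)) \<in> borel_measurable \<mu>"
        by (intro meas measurable_compose[OF _ borel_measurable_exp] borel_measurable_add borel_measurable_times
            borel_measurable_const Rm lipschitz_measurable[OF G])
      show "integrable \<mu> (\<lambda>x. 1 + ?e * G x + ?e\<^sup>2 / 2 * (G x)\<^sup>2 + ?e ^ 3 / 6 * G x ^ 3 + ?e\<^sup>2 * (R n x * exp (?e * G x)))"
        by (intro int exp_growth_add exp_growth_mult exp_growth_power exp_growth_const growth R_growth eG)
    qed simp
    have "(\<integral>\<^sup>+x. ennreal (exp (- (?e * G x))) \<partial>\<mu>) * (\<integral>\<^sup>+x. ennreal (exp (?e * G x + ?e\<^sup>2 * R n x)) \<partial>\<mu>) \<le> 1"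
      using uniformly_log_concave_infimum_convolution[OF \<kappa> \<rho> nonneg prob[unfolded \<mu>_def] concave G e(1)[of n]]
      unfolding \<mu>_def R_def .
    with mult_mono[OF X Y] show ?thesis
      by (rule order_trans) simp_all
  qed
  have ev: "\<forall>\<^sub>F n in sequentially. (s - e n * \<tau>) + (s + e n * \<tau> + r n)
      + (e n)\<^sup>2 * ((s - e n * \<tau>) * (s + e n * \<tau> + r n)) \<le> 0"
    using order_tendstoD(1)[OF X_lim, of 0, simplified] order_tendstoD(1)[OF Y_lim, of 0, simplified]
  proof eventually_elim
    case (elim n)
    then have "X n * Y n \<le> 1"
      using XY[of n] by (simp add: ennreal_mult[symmetric])
    then have "(e n)\<^sup>2 * ((s - e n * \<tau>) + (s + e n * \<tau> + r n)
      + (e n)\<^sup>2 * ((s - e n * \<tau>) * (s + e n * \<tau> + r n))) \<le> 0"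
      by (simp add: X_def Y_def algebra_simps)
    then show ?case
      using e(1)[of n] by (simp add: mult_le_0_iff)
  qed
  have "(s - 0 * \<tau>) + (s + 0 * \<tau> + (- q)) + 0\<^sup>2 * ((s - 0 * \<tau>) * (s + 0 * \<tau> + (- q))) \<le> 0"
    by (rule tendsto_upperbound[OF _ ev sequentially_bot]) (intro tendsto_intros e_lim r_lim_q)
  then show ?thesis
    by (simp add: s_def q_def G_def m_def)
qed

section \<open>Smooth functions and Laplace transforms\<close>

lemma frechet_derivative_eq:
  "(f has_derivative f') (at x) \<Longrightarrow> frechet_derivative f (at x) = f'"
  by (rule frechet_derivative_at[symmetric])

lemma differentiable_imp_continuous_UNIV:
  fixes f :: "'a::euclidean_space \<Rightarrow> real"
  assumes "\<And>x. f differentiable (at x)"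
  shows "continuous_on UNIV f"
  using assms by (simp add: continuous_on_eq_continuous_at differentiable_imp_continuous_within)

lemma times_differentiable_Suc_imp:
  "times_differentiable (Suc k) f \<Longrightarrow> times_differentiable k f"
proof (induction k arbitrary: f)
  case 0
  then show ?case by (simp add: differentiable_imp_continuous_UNIV)
next
  case (Suc k)
  then show ?case
    unfolding times_differentiable.simps(2)[of "Suc k"] times_differentiable.simps(2)[of k] by blast
qed

lemma times_differentiable_const: "times_differentiable k (\<lambda>_. c)"
  by (induction k arbitrary: c) (auto simp: frechet_derivative_const)

lemma times_differentiable_add:
  assumes "times_differentiable k f" "times_differentiable k g"
  shows "times_differentiable k (\<lambda>x. f x + g x)"
  using assms
proof (induction k arbitrary: f g)
  case 0
  then show ?case by (simp add: continuous_on_add)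
next
  case (Suc k)
  then have "frechet_derivative (\<lambda>x. f x + g x) (at x) v
      = frechet_derivative f (at x) v + frechet_derivative g (at x) v" for x v
    by (intro frechet_derivative_eq[THEN fun_cong] has_derivative_add)
       (auto simp: frechet_derivative_works)
  with Suc show ?case by (simp add: differentiable_add)
qed

lemma times_differentiable_mult:
  assumes "times_differentiable k f" "times_differentiable k g"
  shows "times_differentiable k (\<lambda>x. f x * g x)"
  using assms
proof (induction k arbitrary: f g)
  case 0
  then show ?case by (simp add: continuous_on_mult)
next
  case (Suc k)
  from Suc.prems have "frechet_derivative (\<lambda>x. f x * g x) (at x) v
      = f x * frechet_derivative g (at x) v + frechet_derivative f (at x) v * g x" for x v
    by (intro frechet_derivative_eq[THEN fun_cong] has_derivative_mult)
       (auto simp: frechet_derivative_works)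
  note eq = this
  have fg: "times_differentiable k f" "times_differentiable k g"
    using Suc.prems times_differentiable_Suc_imp by blast+
  show ?case
    unfolding times_differentiable.simps eq
    using Suc.prems fg by (auto intro!: differentiable_mult times_differentiable_add Suc.IH)
qed

lemma times_differentiable_inverse:
  assumes "times_differentiable k f" "\<And>x. f x \<noteq> 0"
  shows "times_differentiable k (\<lambda>x. inverse (f x))"
  using assms
proof (induction k arbitrary: f)
  case 0
  then show ?case by (simp add: continuous_on_inverse)
next
  case (Suc k)
  have deriv: "((\<lambda>x. inverse (f x)) has_derivative
      (\<lambda>h. - (inverse (f x) * frechet_derivative f (at x) h * inverse (f x)))) (at x)" for x
    using Suc.prems by (intro Deriv.has_derivative_inverse) (auto simp: frechet_derivative_works)
  have eq: "frechet_derivative (\<lambda>x. inverse (f x)) (at x) v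
      = - 1 * (inverse (f x) * frechet_derivative f (at x) v * inverse (f x))" for x v
    using frechet_derivative_eq[OF deriv, of x] by simp
  have "times_differentiable k (\<lambda>x. inverse (f x))"
    using Suc.IH Suc.prems times_differentiable_Suc_imp by blast
  moreover have "times_differentiable k (\<lambda>x. frechet_derivative f (at x) v)" for v
    using Suc.prems(1) by simp
  ultimately have "times_differentiable k (\<lambda>x. - 1 * (inverse (f x) * frechet_derivative f (at x) v * inverse (f x)))" for v
    by (intro times_differentiable_mult times_differentiable_const)
  then show ?case
    unfolding times_differentiable.simps eq using deriv by (auto simp: differentiable_def)
qed

lemma exp_quadratic_remainder: "\<bar>exp u - 1 - u\<bar> \<le> u\<^sup>2 * exp \<bar>u\<bar>" for u :: real
proof -
  obtain t where t: "\<bar>t\<bar> \<le> \<bar>u\<bar>" "exp u = (\<Sum>m<2. u ^ m / fact m) + exp t / fact 2 * u ^ 2"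
    using Maclaurin_exp_le by blast
  then have "exp u - 1 - u = exp t / 2 * u\<^sup>2"
    by (simp add: eval_nat_numeral)
  then have "\<bar>exp u - 1 - u\<bar> = u\<^sup>2 * (exp t / 2)"
    by (simp only: abs_mult) (simp add: mult.commute)
  also have "exp t / 2 \<le> exp \<bar>u\<bar>"
  proof -
    have "exp t \<le> exp \<bar>u\<bar>"
      using t by simp
    then show ?thesis
      using exp_gt_zero[of t] by linarith
  qed
  then have "u\<^sup>2 * (exp t / 2) \<le> u\<^sup>2 * exp \<bar>u\<bar>"
    by (rule mult_left_mono) simp
  finally show ?thesis .
qed

text \<open>The integral of \<open>(u - t * w)^2\<close> is a quadratic polynomial in \<open>t\<close> that never becomes negative.\<close>

lemma integral_Cauchy_Schwarz:
  fixes u w :: "'a \<Rightarrow> real"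
  assumes [simp]: "integrable M (\<lambda>x. (u x)\<^sup>2)" "integrable M (\<lambda>x. (w x)\<^sup>2)" "integrable M (\<lambda>x. u x * w x)"
  shows "(\<integral>x. u x * w x \<partial>M)\<^sup>2 \<le> (\<integral>x. (u x)\<^sup>2 \<partial>M) * (\<integral>x. (w x)\<^sup>2 \<partial>M)"
proof -
  define A B C where "A = (\<integral>x. (u x)\<^sup>2 \<partial>M)" and "B = (\<integral>x. u x * w x \<partial>M)" and "C = (\<integral>x. (w x)\<^sup>2 \<partial>M)"
  have q: "0 \<le> A - 2 * t * B + t\<^sup>2 * C" for t
  proof -
    have "0 \<le> (\<integral>x. (u x - t * w x)\<^sup>2 \<partial>M)"
      by (intro integral_nonneg_AE AE_I2) simp
    also have "\<dots> = (\<integral>x. (u x)\<^sup>2 - 2 * t * (u x * w x) + t\<^sup>2 * (w x)\<^sup>2 \<partial>M)"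
      by (intro Bochner_Integration.integral_cong refl) (simp add: power2_eq_square algebra_simps)
    also have "\<dots> = A - 2 * t * B + t\<^sup>2 * C"
      by (simp add: A_def B_def C_def)
    finally show ?thesis .
  qed
  have "0 \<le> C"
    unfolding C_def by (intro integral_nonneg_AE AE_I2) simp
  show ?thesis
  proof (cases "C = 0")
    case True
    have "B = 0"
    proof (rule ccontr)
      assume "B \<noteq> 0"
      then show False
        using q[of "(A + 1) / (2 * B)"] True by simp
    qed
    then show ?thesis
      using True by (simp add: A_def B_def C_def)
  next
    case False
    then have "0 < C" using \<open>0 \<le> C\<close> by simp
    then have "B\<^sup>2 / C \<le> A"
      using q[of "B / C"] by (simp add: power2_eq_square field_simps)
    then show ?thesis
      using \<open>0 < C\<close> by (simp add: field_simps A_def B_def C_def)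
  qed
qed

text \<open>The weight \<open>p\<close> makes the class of these functions closed under differentiation: a derivative in
  \<open>y\<close> only multiplies \<open>p\<close> by a linear function.\<close>

definition laplace_transform :: "'a::euclidean_space measure \<Rightarrow> real \<Rightarrow> ('a \<Rightarrow> real) \<Rightarrow> 'a \<Rightarrow> real" where
  "laplace_transform N c p y = (\<integral>z. p z * exp (c * (z \<bullet> y)) \<partial>N)"

lemma exp_growth_norm: "exp_growth norm"
  by (rule exp_growth_lipschitz[where L=1]) (auto intro!: lipschitz_onI simp: dist_norm norm_triangle_ineq3)

lemma exp_growth_exp_norm: "exp_growth (\<lambda>z. exp (a * norm z))"
  by (rule exp_growth_exp_lipschitz[where L=1]) (auto intro!: lipschitz_onI simp: dist_norm norm_triangle_ineq3)

lemma exp_growth_exp_inner: "exp_growth (\<lambda>z. exp (a * (z \<bullet> v)))"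
  by (rule exp_growth_exp_lipschitz[OF lipschitz_inner])

lemma exp_growth_abs: "exp_growth p \<Longrightarrow> exp_growth (\<lambda>z. \<bar>p z\<bar>)"
  by (rule exp_growth_dominated[of p]) (auto simp: exp_growth_def)

lemmas exp_growth_intros = exp_growth_const exp_growth_mult exp_growth_add exp_growth_diff exp_growth_power exp_growth_inner
  exp_growth_norm exp_growth_exp_norm exp_growth_exp_inner exp_growth_abs

lemma has_derivative_quadratic_remainder:
  fixes f :: "'a::euclidean_space \<Rightarrow> real"
  assumes "linear f'" and bound: "\<And>h. norm h \<le> 1 \<Longrightarrow> \<bar>f (y + h) - f y - f' h\<bar> \<le> K * (norm h)\<^sup>2"
  shows "(f has_derivative f') (at y)"
  unfolding has_derivative_at_alt
proof (intro conjI allI impI)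
  show "bounded_linear f'"
    using assms(1) by (simp add: linear_conv_bounded_linear)
  fix e :: real assume "0 < e"
  show "\<exists>d>0. \<forall>z. norm (z - y) < d \<longrightarrow> norm (f z - f y - f' (z - y)) \<le> e * norm (z - y)"
  proof (intro exI conjI allI impI)
    show "0 < min 1 (e / (\<bar>K\<bar> + 1))"
      using \<open>0 < e\<close> by simp
    fix z assume z: "norm (z - y) < min 1 (e / (\<bar>K\<bar> + 1))"
    then have "\<bar>f z - f y - f' (z - y)\<bar> \<le> K * (norm (z - y))\<^sup>2"
      using bound[of "z - y"] by simp
    also have "\<dots> \<le> (\<bar>K\<bar> + 1) * norm (z - y) * norm (z - y)"
      unfolding power2_eq_square mult.assoc[symmetric] by (intro mult_right_mono) auto
    also have "\<dots> \<le> e * norm (z - y)"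
      using z by (intro mult_right_mono) (simp_all add: pos_less_divide_eq mult.commute less_imp_le)
    finally show "norm (f z - f y - f' (z - y)) \<le> e * norm (z - y)"
      by simp
  qed
qed

text \<open>Expanding \<open>exp\<close> to first order under the integral leaves a remainder of order \<open>|h|^2\<close>, with a constant that
  is finite because the measure integrates every function of exponential growth.\<close>

lemma laplace_transform_has_derivative:
  assumes N: "has_exp_moments N" and p: "exp_growth p"
  shows "(laplace_transform N c p has_derivative
    (\<lambda>h. laplace_transform N c (\<lambda>z. c * (z \<bullet> h) * p z) y)) (at y)"
proof (rule has_derivative_quadratic_remainder)
  have int: "integrable N u" if "exp_growth u" for u
    by (rule integrable_exp_growth[OF N that])
  show "linear (\<lambda>h. laplace_transform N c (\<lambda>z. c * (z \<bullet> h) * p z) y)"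
  proof (rule linearI)
    fix h k and a :: real
    have "laplace_transform N c (\<lambda>z. c * (z \<bullet> (h + k)) * p z) y
        = (\<integral>z. c * (z \<bullet> h) * p z * exp (c * (z \<bullet> y)) + c * (z \<bullet> k) * p z * exp (c * (z \<bullet> y)) \<partial>N)"
      unfolding laplace_transform_def
      by (intro Bochner_Integration.integral_cong refl) (simp add: inner_add_right algebra_simps)
    also have "\<dots> = laplace_transform N c (\<lambda>z. c * (z \<bullet> h) * p z) y + laplace_transform N c (\<lambda>z. c * (z \<bullet> k) * p z) y"
      unfolding laplace_transform_def
      by (intro Bochner_Integration.integral_add int exp_growth_intros p)
    finally show "laplace_transform N c (\<lambda>z. c * (z \<bullet> (h + k)) * p z) y
        = laplace_transform N c (\<lambda>z. c * (z \<bullet> h) * p z) y + laplace_transform N c (\<lambda>z. c * (z \<bullet> k) * p z) y" .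
    have "laplace_transform N c (\<lambda>z. c * (z \<bullet> (a *\<^sub>R h)) * p z) y
        = (\<integral>z. a * (c * (z \<bullet> h) * p z * exp (c * (z \<bullet> y))) \<partial>N)"
      unfolding laplace_transform_def
      by (intro Bochner_Integration.integral_cong refl) simp
    then show "laplace_transform N c (\<lambda>z. c * (z \<bullet> (a *\<^sub>R h)) * p z) y
        = a *\<^sub>R laplace_transform N c (\<lambda>z. c * (z \<bullet> h) * p z) y"
      by (simp add: laplace_transform_def)
  qed
  let ?w = "\<lambda>z. \<bar>p z\<bar> * exp (c * (z \<bullet> y)) * (c\<^sup>2 * (norm z)\<^sup>2 * exp (\<bar>c\<bar> * norm z))"
  fix h :: 'a assume h: "norm h \<le> 1"
  have diff: "laplace_transform N c p (y + h) - laplace_transform N c p y - laplace_transform N c (\<lambda>z. c * (z \<bullet> h) * p z) y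
      = (\<integral>z. p z * exp (c * (z \<bullet> (y + h))) - p z * exp (c * (z \<bullet> y)) - c * (z \<bullet> h) * p z * exp (c * (z \<bullet> y)) \<partial>N)"
    unfolding laplace_transform_def
    by (subst Bochner_Integration.integral_diff, (intro int exp_growth_intros p)+)+ simp
  have "\<bar>laplace_transform N c p (y + h) - laplace_transform N c p y - laplace_transform N c (\<lambda>z. c * (z \<bullet> h) * p z) y\<bar>
      \<le> (\<integral>z. ?w z * (norm h)\<^sup>2 \<partial>N)"
    unfolding diff
  proof (rule integral_abs_bound_integral)
    fix z
    let ?u = "c * (z \<bullet> h)"
    have u: "\<bar>?u\<bar> \<le> \<bar>c\<bar> * norm z * norm h"
      by (simp add: abs_mult mult.assoc Cauchy_Schwarz_ineq2 mult_left_mono)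
    also have "\<dots> \<le> \<bar>c\<bar> * norm z"
      using h by (simp add: mult_left_le)
    finally have u': "\<bar>?u\<bar> \<le> \<bar>c\<bar> * norm z" .
    have "?u\<^sup>2 \<le> (\<bar>c\<bar> * norm z * norm h)\<^sup>2"
      using u by (metis abs_ge_zero power2_abs power_mono)
    then have "?u\<^sup>2 * exp \<bar>?u\<bar> \<le> (\<bar>c\<bar> * norm z * norm h)\<^sup>2 * exp (\<bar>c\<bar> * norm z)"
      using u' by (intro mult_mono) auto
    with exp_quadratic_remainder[of ?u]
    have rem: "\<bar>exp ?u - 1 - ?u\<bar> \<le> c\<^sup>2 * (norm z)\<^sup>2 * exp (\<bar>c\<bar> * norm z) * (norm h)\<^sup>2"
      by (simp add: power_mult_distrib ac_simps)
    have "\<bar>p z * exp (c * (z \<bullet> (y + h))) - p z * exp (c * (z \<bullet> y)) - c * (z \<bullet> h) * p z * exp (c * (z \<bullet> y))\<bar>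
        = \<bar>p z * exp (c * (z \<bullet> y)) * (exp ?u - 1 - ?u)\<bar>"
      by (simp add: inner_add_right distrib_left exp_add algebra_simps)
    also have "\<dots> = \<bar>p z\<bar> * exp (c * (z \<bullet> y)) * \<bar>exp ?u - 1 - ?u\<bar>"
      by (simp add: abs_mult)
    also have "\<dots> \<le> \<bar>p z\<bar> * exp (c * (z \<bullet> y)) * (c\<^sup>2 * (norm z)\<^sup>2 * exp (\<bar>c\<bar> * norm z) * (norm h)\<^sup>2)"
      by (intro mult_left_mono rem) auto
    finally show "\<bar>p z * exp (c * (z \<bullet> (y + h))) - p z * exp (c * (z \<bullet> y)) - c * (z \<bullet> h) * p z * exp (c * (z \<bullet> y))\<bar>
        \<le> ?w z * (norm h)\<^sup>2"
      by (simp only: mult.assoc)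
  qed (intro int exp_growth_intros p)+
  then show "\<bar>laplace_transform N c p (y + h) - laplace_transform N c p y - laplace_transform N c (\<lambda>z. c * (z \<bullet> h) * p z) y\<bar>
      \<le> (\<integral>z. ?w z \<partial>N) * (norm h)\<^sup>2"
    by simp
qed

lemma times_differentiable_laplace_transform:
  assumes N: "has_exp_moments N" and p: "exp_growth p"
  shows "times_differentiable k (laplace_transform N c p)"
  using p
proof (induction k arbitrary: p)
  case 0
  have "laplace_transform N c p differentiable (at x)" for x
    using laplace_transform_has_derivative[OF N 0] by (auto simp: differentiable_def)
  then show ?case
    by (simp add: differentiable_imp_continuous_UNIV)
next
  case (Suc k)
  note deriv = laplace_transform_has_derivative[OF N Suc.prems]
  have "times_differentiable k (\<lambda>x. laplace_transform N c (\<lambda>z. c * (z \<bullet> v) * p z) x)" for v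
    by (intro Suc.IH exp_growth_intros Suc.prems)
  then show ?case
    using deriv unfolding times_differentiable.simps frechet_derivative_eq[OF deriv]
    by (auto simp: differentiable_def)
qed

section \<open>Gradients\<close>

lemma GDERIV_unique:
  assumes "GDERIV f x :> D" "GDERIV f x :> D'"
  shows "D = D'"
proof -
  have "(\<lambda>h. h \<bullet> D) = (\<lambda>h. h \<bullet> D')"
    using assms has_derivative_unique unfolding gderiv_def by blast
  then have "\<forall>h. h \<bullet> D = h \<bullet> D'"
    by (simp add: fun_eq_iff)
  then show ?thesis
    by (simp add: vector_eq_ldot)
qed

lemma GDERIV_Riesz:
  fixes f :: "'a::euclidean_space \<Rightarrow> real"
  assumes "(f has_derivative f') (at x)"
  obtains D where "GDERIV f x :> D" "\<And>h. h \<bullet> D = f' h"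
proof
  have lin: "linear f'"
    using assms by (simp add: has_derivative_linear)
  show eq: "h \<bullet> (\<Sum>b\<in>Basis. f' b *\<^sub>R b) = f' h" for h
  proof -
    have "h \<bullet> (\<Sum>b\<in>Basis. f' b *\<^sub>R b) = (\<Sum>b\<in>Basis. (h \<bullet> b) * f' b)"
      by (simp add: inner_sum_right mult.commute)
    also have "\<dots> = f' (\<Sum>b\<in>Basis. (h \<bullet> b) *\<^sub>R b)"
      using lin by (simp add: linear_sum linear_scale)
    finally show ?thesis
      by (simp add: euclidean_representation)
  qed
  show "GDERIV f x :> (\<Sum>b\<in>Basis. f' b *\<^sub>R b)"
    using assms unfolding gderiv_def eq by simp
qed

lemma gradient_eqI: "GDERIV f x :> D \<Longrightarrow> gradient f x = D"
  unfolding gradient_def by (blast intro: GDERIV_unique)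

lemma smooth_GDERIV: "smooth f \<Longrightarrow> GDERIV f x :> gradient f x"
proof -
  assume "smooth f"
  then have "times_differentiable (Suc 0) f"
    unfolding smooth_def by blast
  then obtain f' where "(f has_derivative f') (at x)"
    by (auto simp: differentiable_def)
  then show ?thesis
    by (metis GDERIV_Riesz gradient_eqI)
qed

section \<open>Gaussian damping and exponential tilting of a log-concave density\<close>

text \<open>Here \<open>p\<close> plays the part of the density of \<open>Z\<close>. In the application, \<open>tilt y\<close> below is the
  conditional law of \<open>Z\<close> given the observation \<open>y\<close>.\<close>

locale gaussian_tilt =
  fixes p :: "'a::euclidean_space \<Rightarrow> real" and \<kappa> c :: real
  assumes p_measurable [measurable]: "p \<in> borel_measurable borel" and p_nonneg: "\<And>x. 0 \<le> p x"
    and p_prob: "prob_space (density lborel p)"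
    and p_concave: "\<And>x y. p x * p y \<le> (p ((x + y) /\<^sub>R 2))\<^sup>2"
    and \<kappa>: "0 < \<kappa>"
begin

definition base :: "'a measure" where
  "base = density lborel (\<lambda>z. p z * exp (- (\<kappa> / 2 * (norm z)\<^sup>2)))"

abbreviation mass :: "'a \<Rightarrow> real" where
  "mass y \<equiv> laplace_transform base c (\<lambda>_. 1) y"

definition \<rho> :: "'a \<Rightarrow> 'a \<Rightarrow> real" where
  "\<rho> y z = p z * exp (- (\<kappa> / 2 * (norm z)\<^sup>2)) * exp (c * (z \<bullet> y)) / mass y"

definition tilt :: "'a \<Rightarrow> 'a measure" where
  "tilt y = density lborel (\<rho> y)"

text \<open>The Gaussian factor absorbs every exponential: \<open>a * s - \<kappa> / 2 * s^2 \<le> a^2 / (2 * \<kappa>)\<close>.\<close>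

lemma base_moments: "has_exp_moments base"
  unfolding has_exp_moments_def
proof (intro conjI allI)
  show "sets base = sets borel"
    by (simp add: base_def)
  fix a
  interpret prob_space "density lborel p" by (rule p_prob)
  have "integrable (density lborel p) (\<lambda>_. exp (a\<^sup>2 / (2 * \<kappa>)))"
    by simp
  then have "integrable lborel (\<lambda>z. p z * exp (a\<^sup>2 / (2 * \<kappa>)))"
    using p_nonneg by (subst (asm) integrable_real_density) auto
  then have "integrable lborel (\<lambda>z. p z * exp (- (\<kappa> / 2 * (norm z)\<^sup>2)) * exp (a * norm z))"
  proof (rule Bochner_Integration.integrable_bound)
    show "AE z in lborel. norm (p z * exp (- (\<kappa> / 2 * (norm z)\<^sup>2)) * exp (a * norm z))
        \<le> norm (p z * exp (a\<^sup>2 / (2 * \<kappa>)))"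
    proof (rule AE_I2)
      fix z :: 'a
      have "- (\<kappa> / 2 * (norm z)\<^sup>2) + a * norm z \<le> a\<^sup>2 / (2 * \<kappa>)"
        using quadratic_lower_bound[of "2 * \<kappa>" a "norm z"] \<kappa> by simp
      then have "exp (- (\<kappa> / 2 * (norm z)\<^sup>2)) * exp (a * norm z) \<le> exp (a\<^sup>2 / (2 * \<kappa>))"
        by (simp add: exp_add[symmetric])
      then show "norm (p z * exp (- (\<kappa> / 2 * (norm z)\<^sup>2)) * exp (a * norm z))
          \<le> norm (p z * exp (a\<^sup>2 / (2 * \<kappa>)))"
        using p_nonneg[of z] by (simp add: abs_mult mult.assoc mult_left_mono)
    qed
  qed simp
  then show "integrable base (\<lambda>z. exp (a * norm z))"
    unfolding base_def using p_nonneg by (subst integrable_real_density) auto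
qed

lemma laplace_transform_base:
  assumes [measurable]: "u \<in> borel_measurable borel"
  shows "laplace_transform base c u y
    = (\<integral>z. p z * exp (- (\<kappa> / 2 * (norm z)\<^sup>2)) * exp (c * (z \<bullet> y)) * u z \<partial>lborel)"
  unfolding laplace_transform_def base_def using p_nonneg
  by (subst integral_real_density) (auto intro!: Bochner_Integration.integral_cong)

lemma base_integrable: "exp_growth u \<Longrightarrow> integrable base u"
  by (rule integrable_exp_growth[OF base_moments])

lemma base_density_integrable:
  assumes u: "exp_growth u"
  shows "integrable lborel (\<lambda>z. p z * exp (- (\<kappa> / 2 * (norm z)\<^sup>2)) * u z)"
  using base_integrable[OF u] p_nonneg exp_growth_measurable[OF u]
  unfolding base_def by (subst (asm) integrable_real_density) auto

lemma mass_pos: "0 < mass y"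
proof -
  have int: "integrable lborel (\<lambda>z. p z * exp (- (\<kappa> / 2 * (norm z)\<^sup>2)) * exp (c * (z \<bullet> y)))"
    by (intro base_density_integrable exp_growth_exp_inner)
  have eq: "mass y = (\<integral>z. p z * exp (- (\<kappa> / 2 * (norm z)\<^sup>2)) * exp (c * (z \<bullet> y)) \<partial>lborel)"
    by (simp add: laplace_transform_base)
  have "0 \<le> mass y"
    unfolding eq using p_nonneg by (intro integral_nonneg_AE AE_I2) simp
  moreover have "mass y \<noteq> 0"
  proof
    assume "mass y = 0"
    then have "AE z in lborel. p z * exp (- (\<kappa> / 2 * (norm z)\<^sup>2)) * exp (c * (z \<bullet> y)) = 0"
      using integral_nonneg_eq_0_iff_AE[OF int] p_nonneg unfolding eq by simp
    then have "AE z in lborel. p z = 0"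
      by simp
    then have "(\<integral>\<^sup>+z. ennreal (p z) \<partial>lborel) = 0"
      by (subst nn_integral_0_iff_AE) auto
    moreover have "(\<integral>\<^sup>+z. ennreal (p z) \<partial>lborel) = 1"
      using prob_space.emeasure_space_1[OF p_prob] by (simp add: emeasure_density)
    ultimately show False by simp
  qed
  ultimately show ?thesis by simp
qed

lemma \<rho>_measurable [measurable]: "\<rho> y \<in> borel_measurable borel"
  unfolding \<rho>_def by measurable

lemma \<rho>_nonneg: "0 \<le> \<rho> y z"
  using mass_pos[of y] p_nonneg[of z] by (simp add: \<rho>_def)

lemma tilt_sets [simp, measurable_cong]: "sets (tilt y) = sets borel"
  by (simp add: tilt_def)

lemma tilt_integrable: "exp_growth u \<Longrightarrow> integrable (tilt y) u"
proof -
  assume u: "exp_growth u"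
  have "integrable lborel (\<lambda>z. p z * exp (- (\<kappa> / 2 * (norm z)\<^sup>2)) * (exp (c * (z \<bullet> y)) * u z) / mass y)"
    by (intro integrable_divide base_density_integrable exp_growth_intros u)
  then show ?thesis
    unfolding tilt_def using \<rho>_nonneg exp_growth_measurable[OF u]
    by (subst integrable_real_density) (auto simp: \<rho>_def mult.assoc)
qed

lemma tilt_integral:
  assumes [measurable]: "u \<in> borel_measurable borel"
  shows "(\<integral>z. u z \<partial>tilt y) = laplace_transform base c u y / mass y"
proof -
  have "(\<integral>z. u z \<partial>tilt y) = (\<integral>z. \<rho> y z * u z \<partial>lborel)"
    unfolding tilt_def using \<rho>_nonneg by (subst integral_real_density) auto
  also have "\<dots> = (\<integral>z. p z * exp (- (\<kappa> / 2 * (norm z)\<^sup>2)) * exp (c * (z \<bullet> y)) * u z / mass y \<partial>lborel)"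
    by (simp add: \<rho>_def)
  also have "\<dots> = laplace_transform base c u y / mass y"
    by (simp add: laplace_transform_base)
  finally show ?thesis .
qed

lemma tilt_prob: "prob_space (tilt y)"
proof
  have "emeasure (tilt y) (space (tilt y)) = (\<integral>\<^sup>+z. ennreal 1 \<partial>tilt y)"
    by simp
  also have "\<dots> = ennreal (\<integral>z. 1 \<partial>tilt y)"
    by (rule nn_integral_eq_integral[OF tilt_integrable]) auto
  also have "(\<integral>z. 1 \<partial>tilt y) = (1 :: real)"
    using tilt_integral[of "\<lambda>_. 1" y] mass_pos[of y] by simp
  finally show "emeasure (tilt y) (space (tilt y)) = 1"
    by simp
qed

lemma tilt_moments: "has_exp_moments (tilt y)"
  unfolding has_exp_moments_def by (auto intro: tilt_integrable exp_growth_exp_norm)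

text \<open>The linear exponent cancels, and by the parallelogram identity the Gaussian factor contributes exactly
  the gain \<open>exp (\<kappa> / 4 * |x - z|^2)\<close>.\<close>

lemma \<rho>_concave: "\<rho> y x * \<rho> y z * exp (\<kappa> / 4 * (norm (x - z))\<^sup>2) \<le> (\<rho> y ((x + z) /\<^sub>R 2))\<^sup>2"
proof -
  let ?m = "(x + z) /\<^sub>R 2"
  have par: "- (\<kappa> / 2 * (norm x)\<^sup>2) + c * (x \<bullet> y) + (- (\<kappa> / 2 * (norm z)\<^sup>2) + c * (z \<bullet> y)) + \<kappa> / 4 * (norm (x - z))\<^sup>2
      = 2 * (- (\<kappa> / 2 * (norm ?m)\<^sup>2) + c * (?m \<bullet> y))"
    by (simp add: power2_norm_eq_inner inner_add_left inner_add_right inner_diff_left inner_diff_right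
        inner_commute[of z x] field_simps)
  have "\<rho> y x * \<rho> y z * exp (\<kappa> / 4 * (norm (x - z))\<^sup>2)
      = p x * p z * exp (- (\<kappa> / 2 * (norm x)\<^sup>2) + c * (x \<bullet> y) + (- (\<kappa> / 2 * (norm z)\<^sup>2) + c * (z \<bullet> y)) + \<kappa> / 4 * (norm (x - z))\<^sup>2)
        / (mass y)\<^sup>2"
    by (simp only: \<rho>_def exp_add) (simp add: power2_eq_square)
  also have "\<dots> \<le> (p ?m)\<^sup>2 * exp (2 * (- (\<kappa> / 2 * (norm ?m)\<^sup>2) + c * (?m \<bullet> y))) / (mass y)\<^sup>2"
    unfolding par by (intro divide_right_mono mult_right_mono p_concave) auto
  also have "\<dots> = (\<rho> y ?m)\<^sup>2"
    by (simp only: \<rho>_def exp_double exp_add power_divide power_mult_distrib)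
  finally show ?thesis .
qed

lemma tilt_poincare:
  assumes "L-lipschitz_on UNIV g" "\<And>x. GDERIV g x :> D x"
  shows "(\<integral>x. (g x - (\<integral>z. g z \<partial>tilt y))\<^sup>2 \<partial>tilt y) \<le> (\<integral>x. (norm (D x))\<^sup>2 \<partial>tilt y) / \<kappa>"
  using poincare_uniformly_log_concave[OF \<kappa> \<rho>_measurable \<rho>_nonneg tilt_prob[unfolded tilt_def]
      tilt_moments[unfolded tilt_def] \<rho>_concave assms]
  unfolding tilt_def .

definition tilt_mean :: "('a \<Rightarrow> real) \<Rightarrow> 'a \<Rightarrow> real" where
  "tilt_mean u y = (\<integral>z. u z \<partial>tilt y)"

lemma tilt_mean_eq:
  assumes "exp_growth u"
  shows "tilt_mean u = (\<lambda>y. laplace_transform base c u y * inverse (mass y))"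
  using tilt_integral[OF exp_growth_measurable[OF assms]] by (simp add: tilt_mean_def fun_eq_iff divide_inverse)

lemma smooth_tilt_mean: "exp_growth u \<Longrightarrow> smooth (tilt_mean u)"
  unfolding smooth_def using mass_pos less_imp_neq
  by (auto simp: tilt_mean_eq less_imp_neq[symmetric] intro!: times_differentiable_mult times_differentiable_inverse
      times_differentiable_laplace_transform base_moments)

text \<open>The logarithmic derivative of the tilting factor is \<open>c * (z \<bullet> h)\<close>, centred by the derivative of the
  normalizing constant, so differentiating a mean produces a covariance.\<close>

lemma tilt_mean_has_derivative:
  assumes u: "exp_growth u"
  shows "(tilt_mean u has_derivative
    (\<lambda>h. c * (\<integral>z. (u z - tilt_mean u y) * (z \<bullet> h - tilt_mean (\<lambda>z. z \<bullet> h) y) \<partial>tilt y))) (at y)"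
proof -
  note deriv = laplace_transform_has_derivative[OF base_moments]
  let ?A = "\<lambda>u. laplace_transform base c u y"
  interpret prob_space "tilt y" by (rule tilt_prob)
  have nz: "mass y \<noteq> 0"
    using mass_pos[of y] by simp
  have "((\<lambda>y. laplace_transform base c u y / mass y) has_derivative
      (\<lambda>h. - ?A u * (inverse (mass y) * ?A (\<lambda>z. c * (z \<bullet> h) * 1) * inverse (mass y))
        + ?A (\<lambda>z. c * (z \<bullet> h) * u z) / mass y)) (at y)"
    by (rule has_derivative_divide[OF deriv[OF u] deriv[OF exp_growth_const] nz])
  moreover have "- ?A u * (inverse (mass y) * ?A (\<lambda>z. c * (z \<bullet> h) * 1) * inverse (mass y)) + ?A (\<lambda>z. c * (z \<bullet> h) * u z) / mass y
      = c * (\<integral>z. (u z - tilt_mean u y) * (z \<bullet> h - tilt_mean (\<lambda>z. z \<bullet> h) y) \<partial>tilt y)" for h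
  proof -
    let ?m = "tilt_mean u y" and ?l = "tilt_mean (\<lambda>z. z \<bullet> h) y"
    have A: "?A v = (\<integral>z. v z \<partial>tilt y) * mass y" if "exp_growth v" for v
      using tilt_integral[OF exp_growth_measurable[OF that], of y] nz by simp
    have 1: "?A u = ?m * mass y"
      using A[OF u] by (simp add: tilt_mean_def)
    have 2: "?A (\<lambda>z. c * (z \<bullet> h) * 1) = c * ?l * mass y"
      by (subst A) (auto intro!: exp_growth_intros simp: tilt_mean_def)
    have 3: "?A (\<lambda>z. c * (z \<bullet> h) * u z) = c * (\<integral>z. u z * (z \<bullet> h) \<partial>tilt y) * mass y"
      by (subst A) (auto intro!: exp_growth_intros u simp: mult.commute[of "_ \<bullet> _"] mult.assoc)
    have "(\<integral>z. (u z - ?m) * (z \<bullet> h - ?l) \<partial>tilt y)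
        = (\<integral>z. u z * (z \<bullet> h) - ?l * u z - ?m * (z \<bullet> h) + ?m * ?l \<partial>tilt y)"
      by (intro Bochner_Integration.integral_cong refl) (simp add: algebra_simps)
    also have "\<dots> = (\<integral>z. u z * (z \<bullet> h) \<partial>tilt y) - ?l * ?m - ?m * ?l + ?m * ?l"
      using tilt_integrable[OF u] tilt_integrable[OF exp_growth_inner[of h]]
        tilt_integrable[OF exp_growth_mult[OF u exp_growth_inner[of h]]]
      by (simp add: tilt_mean_def prob_space)
    finally have 4: "(\<integral>z. (u z - ?m) * (z \<bullet> h - ?l) \<partial>tilt y) = (\<integral>z. u z * (z \<bullet> h) \<partial>tilt y) - ?m * ?l"
      by simp
    show ?thesis
      unfolding 1 2 3 4 using nz by (simp add: field_simps)
  qed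
  ultimately show ?thesis
    by (simp add: tilt_mean_eq[OF u] divide_inverse)
qed

text \<open>In the direction \<open>G\<close> the derivative formula reads \<open>|G|^2 = c * Cov (g, z \<bullet> G)\<close>. Cauchy-Schwarz and two applications of the
  Poincare inequality for the tilted measure, to \<open>g\<close> and to \<open>z \<bullet> G\<close>, bound the
  right-hand side by a multiple of \<open>|G|\<close>.\<close>

lemma tilt_mean_gradient_bound:
  assumes g: "L-lipschitz_on UNIV g" and D: "\<And>x. GDERIV g x :> D x" and G: "GDERIV (tilt_mean g) y :> G"
  shows "(norm G)\<^sup>2 \<le> (c / \<kappa>)\<^sup>2 * (\<integral>x. (norm (D x))\<^sup>2 \<partial>tilt y)"
proof -
  interpret prob_space "tilt y" by (rule tilt_prob)
  let ?u = "\<lambda>z. g z - tilt_mean g y" and ?w = "\<lambda>z. z \<bullet> G - tilt_mean (\<lambda>z. z \<bullet> G) y"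
  define S where "S = (\<integral>x. (norm (D x))\<^sup>2 \<partial>tilt y)"
  have S: "0 \<le> S"
    unfolding S_def by (intro integral_nonneg_AE AE_I2) simp
  have u: "exp_growth ?u" and w: "exp_growth ?w"
    by (intro exp_growth_intros exp_growth_lipschitz[OF g])+
  have "(\<lambda>h. h \<bullet> G) = (\<lambda>h. c * (\<integral>z. ?u z * (z \<bullet> h - tilt_mean (\<lambda>z. z \<bullet> h) y) \<partial>tilt y))"
    using G tilt_mean_has_derivative[OF exp_growth_lipschitz[OF g]] has_derivative_unique
    unfolding gderiv_def by blast
  then have "(norm G)\<^sup>2 = c * (\<integral>z. ?u z * ?w z \<partial>tilt y)"
    by (simp add: power2_norm_eq_inner fun_eq_iff)
  then have "((norm G)\<^sup>2)\<^sup>2 = c\<^sup>2 * (\<integral>z. ?u z * ?w z \<partial>tilt y)\<^sup>2"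
    by (simp add: power_mult_distrib)
  also have "\<dots> \<le> c\<^sup>2 * ((\<integral>z. (?u z)\<^sup>2 \<partial>tilt y) * (\<integral>z. (?w z)\<^sup>2 \<partial>tilt y))"
    by (intro mult_left_mono integral_Cauchy_Schwarz tilt_integrable exp_growth_intros u w) simp
  also have "\<dots> \<le> c\<^sup>2 * (S / \<kappa> * ((norm G)\<^sup>2 / \<kappa>))"
  proof (intro mult_left_mono mult_mono)
    show "(\<integral>z. (?u z)\<^sup>2 \<partial>tilt y) \<le> S / \<kappa>"
      using tilt_poincare[OF g D, of y] by (simp add: tilt_mean_def S_def)
    have "GDERIV (\<lambda>z. z \<bullet> G) x :> G" for x
      unfolding gderiv_def by (auto intro!: derivative_eq_intros)
    from tilt_poincare[OF lipschitz_inner this, of y]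
    show "(\<integral>z. (?w z)\<^sup>2 \<partial>tilt y) \<le> (norm G)\<^sup>2 / \<kappa>"
      by (simp add: tilt_mean_def prob_space)
  qed (use S \<kappa> in \<open>auto intro!: integral_nonneg_AE\<close>)
  finally have *: "(norm G)\<^sup>2 * (norm G)\<^sup>2 \<le> ((c / \<kappa>)\<^sup>2 * S) * (norm G)\<^sup>2"
    by (simp add: power2_eq_square field_simps)
  show ?thesis
  proof (cases "G = 0")
    case True
    then show ?thesis
      using S by (simp add: S_def)
  next
    case False
    then have "0 < (norm G)\<^sup>2"
      by simp
    with * show ?thesis
      unfolding S_def by (rule mult_right_le_imp_le)
  qed
qed

lemma tilt_mean_lipschitz:
  assumes g: "L-lipschitz_on UNIV g" and D: "\<And>x. GDERIV g x :> D x"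
  shows "(\<bar>c\<bar> / \<kappa> * L)-lipschitz_on UNIV (tilt_mean g)"
proof -
  have L: "0 \<le> L"
    by (rule lipschitz_on_nonneg[OF g])
  have smooth: "smooth (tilt_mean g)"
    by (rule smooth_tilt_mean[OF exp_growth_lipschitz[OF g]])
  have bound: "norm (gradient (tilt_mean g) y) \<le> \<bar>c\<bar> / \<kappa> * L" for y
  proof -
    interpret prob_space "tilt y" by (rule tilt_prob)
    have "(\<integral>x. (norm (D x))\<^sup>2 \<partial>tilt y) \<le> (\<integral>x. L\<^sup>2 \<partial>tilt y)"
    proof (rule integral_mono)
      show "integrable (tilt y) (\<lambda>x. (norm (D x))\<^sup>2)"
        using GDERIV_norm_le[OF g D] GDERIV_norm_measurable[OF g D]
        by (intro tilt_integrable exp_growthI[where K="L\<^sup>2" and a=0]) auto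
    qed (use GDERIV_norm_le[OF g D] in auto)
    then have "(c / \<kappa>)\<^sup>2 * (\<integral>x. (norm (D x))\<^sup>2 \<partial>tilt y) \<le> (c / \<kappa>)\<^sup>2 * L\<^sup>2"
      by (intro mult_left_mono) (simp_all add: prob_space)
    then have "(norm (gradient (tilt_mean g) y))\<^sup>2 \<le> (\<bar>c\<bar> / \<kappa> * L)\<^sup>2"
      using tilt_mean_gradient_bound[OF g D smooth_GDERIV[OF smooth], of y]
      by (simp add: power_mult_distrib power_divide)
    then show ?thesis
      by (rule power2_le_imp_le) (use L \<kappa> in auto)
  qed
  show ?thesis
  proof (rule bounded_derivative_imp_lipschitz)
    show "(tilt_mean g has_derivative (\<lambda>h. h \<bullet> gradient (tilt_mean g) x)) (at x within UNIV)" for x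
      using smooth_GDERIV[OF smooth, of x] by (simp add: gderiv_def)
    show "onorm (\<lambda>h. h \<bullet> gradient (tilt_mean g) x) \<le> \<bar>c\<bar> / \<kappa> * L" for x
    proof (rule onorm_bound)
      fix h
      have "norm (h \<bullet> gradient (tilt_mean g) x) \<le> norm h * norm (gradient (tilt_mean g) x)"
        using Cauchy_Schwarz_ineq2 by simp
      also have "\<dots> \<le> norm h * (\<bar>c\<bar> / \<kappa> * L)"
        by (intro mult_left_mono bound) simp
      finally show "norm (h \<bullet> gradient (tilt_mean g) x) \<le> \<bar>c\<bar> / \<kappa> * L * norm h"
        by (simp add: mult.commute)
    qed (use L \<kappa> in simp)
  qed (use L \<kappa> in auto)
qed

end

section \<open>Conditioning on a noisy observation\<close>

lemma nn_integral_lborel_affine: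
  fixes H :: "'a::euclidean_space \<Rightarrow> ennreal"
  assumes [measurable]: "H \<in> borel_measurable borel" and s: "0 < s"
  shows "(\<integral>\<^sup>+x. H x \<partial>lborel) = (\<integral>\<^sup>+x. ennreal (s ^ DIM('a)) * H (t + s *\<^sub>R x) \<partial>lborel)"
  by (subst lborel_affine[of s t]) (use s in \<open>simp_all add: nn_integral_density nn_integral_distr\<close>)

lemma std_gaussian_density_measurable [measurable]: "std_gaussian_density \<in> borel_measurable borel"
  unfolding std_gaussian_density_def by measurable

lemma std_gaussian_density_nonneg: "0 \<le> std_gaussian_density x"
  by (simp add: std_gaussian_density_def)

text \<open>By independence the left-hand side is an iterated integral over the laws of \<open>Z\<close> and \<open>G\<close>; for fixed \<open>z\<close> the
  substitution \<open>y = a *\<^sub>R z + s *\<^sub>R g\<close> turns the Gaussian integral into one over \<open>y\<close>.\<close>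

lemma joint_law_with_gaussian_noise:
  fixes Z G :: "'w \<Rightarrow> 'a::euclidean_space" and p :: "'a \<Rightarrow> real"
  assumes M: "prob_space M"
    and G: "distributed M lborel G (\<lambda>x. ennreal (std_gaussian_density x))"
    and indep: "prob_space.indep_var M borel Z borel G"
    and p [measurable]: "p \<in> borel_measurable borel" and Z: "distr M borel Z = density lborel p"
    and s: "0 < s"
    and \<Psi>: "case_prod \<Psi> \<in> borel_measurable (borel \<Otimes>\<^sub>M borel)"
  shows "(\<integral>\<^sup>+\<omega>. \<Psi> (Z \<omega>) (a *\<^sub>R Z \<omega> + s *\<^sub>R G \<omega>) \<partial>M)
    = (\<integral>\<^sup>+z. \<integral>\<^sup>+y. ennreal (p z) * (ennreal (std_gaussian_density ((y - a *\<^sub>R z) /\<^sub>R s) / s ^ DIM('a)) * \<Psi> z y) \<partial>lborel \<partial>lborel)"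
proof -
  interpret prob_space M by (rule M)
  let ?\<gamma> = "density lborel (\<lambda>x::'a. ennreal (std_gaussian_density x))"
  have \<Psi>' [measurable]: "(\<lambda>x. \<Psi> (f x) (g x)) \<in> borel_measurable N"
    if "f \<in> borel_measurable N" "g \<in> borel_measurable N" for f g and N :: "'b measure"
    using measurable_compose[OF measurable_Pair[OF that] \<Psi>] by simp
  have rv: "Z \<in> borel_measurable M" "G \<in> borel_measurable M"
    and joint: "distr M borel Z \<Otimes>\<^sub>M distr M borel G = distr M (borel \<Otimes>\<^sub>M borel) (\<lambda>x. (Z x, G x))"
    using indep by (auto simp: indep_var_distribution_eq)
  have DG: "distr M borel G = ?\<gamma>"
    using distributed_distr_eq_density[OF G] by (simp cong: distr_cong)
  interpret \<gamma>: prob_space ?\<gamma>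
    using prob_space_distr[OF rv(2)] by (simp add: DG)
  have Pm: "(\<lambda>x. \<Psi> (fst x) (a *\<^sub>R fst x + s *\<^sub>R snd x)) \<in> borel_measurable (borel \<Otimes>\<^sub>M borel)"
    using measurable_compose[OF measurable_Pair[OF _ _] \<Psi>, of fst "borel \<Otimes>\<^sub>M borel" "\<lambda>x. a *\<^sub>R fst x + s *\<^sub>R snd x"]
    by simp
  then have Pm': "(\<lambda>x. \<Psi> (fst x) (a *\<^sub>R fst x + s *\<^sub>R snd x)) \<in> borel_measurable (density lborel p \<Otimes>\<^sub>M ?\<gamma>)"
    by (simp cong: measurable_cong_sets sets_pair_measure_cong)
  have "(\<integral>\<^sup>+\<omega>. \<Psi> (Z \<omega>) (a *\<^sub>R Z \<omega> + s *\<^sub>R G \<omega>) \<partial>M)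
      = (\<integral>\<^sup>+x. \<Psi> (fst x) (a *\<^sub>R fst x + s *\<^sub>R snd x) \<partial>distr M (borel \<Otimes>\<^sub>M borel) (\<lambda>x. (Z x, G x)))"
    using Pm rv by (subst nn_integral_distr) auto
  also have "\<dots> = (\<integral>\<^sup>+x. \<Psi> (fst x) (a *\<^sub>R fst x + s *\<^sub>R snd x) \<partial>(density lborel p \<Otimes>\<^sub>M ?\<gamma>))"
    by (simp add: joint[symmetric] DG Z)
  also have "\<dots> = (\<integral>\<^sup>+z. \<integral>\<^sup>+g. \<Psi> z (a *\<^sub>R z + s *\<^sub>R g) \<partial>?\<gamma> \<partial>density lborel p)"
    using \<gamma>.nn_integral_fst[OF Pm'] by simp
  also have "\<dots> = (\<integral>\<^sup>+z. ennreal (p z) * (\<integral>\<^sup>+g. \<Psi> z (a *\<^sub>R z + s *\<^sub>R g) \<partial>?\<gamma>) \<partial>lborel)"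
    using \<gamma>.borel_measurable_nn_integral_fst[OF Pm'] by (subst nn_integral_density) auto
  also have "\<dots> = (\<integral>\<^sup>+z. \<integral>\<^sup>+y. ennreal (p z) * (ennreal (std_gaussian_density ((y - a *\<^sub>R z) /\<^sub>R s) / s ^ DIM('a)) * \<Psi> z y) \<partial>lborel \<partial>lborel)"
  proof (rule nn_integral_cong)
    fix z
    have mz: "(\<lambda>y. \<Psi> z (f y)) \<in> borel_measurable borel" if "f \<in> borel_measurable borel" for f :: "'a \<Rightarrow> 'a"
      using measurable_compose[OF measurable_Pair[OF measurable_const that] \<Psi>, of z] by simp
    note [measurable] = mz[of "\<lambda>y. y", simplified] mz[of "\<lambda>g. a *\<^sub>R z + s *\<^sub>R g", simplified]
    have "(\<integral>\<^sup>+g. \<Psi> z (a *\<^sub>R z + s *\<^sub>R g) \<partial>?\<gamma>) = (\<integral>\<^sup>+g. ennreal (std_gaussian_density g) * \<Psi> z (a *\<^sub>R z + s *\<^sub>R g) \<partial>lborel)"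
      by (subst nn_integral_density) auto
    also have "\<dots> = (\<integral>\<^sup>+y. ennreal (std_gaussian_density ((y - a *\<^sub>R z) /\<^sub>R s) / s ^ DIM('a)) * \<Psi> z y \<partial>lborel)"
      using s by (subst nn_integral_lborel_affine[OF _ s, of _ "a *\<^sub>R z"])
        (auto simp: mult.assoc[symmetric] ennreal_mult[symmetric] std_gaussian_density_nonneg)
    finally show "ennreal (p z) * (\<integral>\<^sup>+g. \<Psi> z (a *\<^sub>R z + s *\<^sub>R g) \<partial>?\<gamma>)
        = (\<integral>\<^sup>+y. ennreal (p z) * (ennreal (std_gaussian_density ((y - a *\<^sub>R z) /\<^sub>R s) / s ^ DIM('a)) * \<Psi> z y) \<partial>lborel)"
      by (subst nn_integral_cmult) auto
  qed
  finally show ?thesis .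
qed

text \<open>Completing the square separates the transition density into a function of \<open>y\<close> and the
  damping and tilting factors that define \<open>tilt y\<close>; this is Bayes' rule for the channel.\<close>

lemma gaussian_kernel_factorization:
  fixes y z :: "'a::euclidean_space"
  assumes r: "0 < r" "r < 1"
  shows "std_gaussian_density ((y - sqrt r *\<^sub>R z) /\<^sub>R sqrt (1 - r)) / sqrt (1 - r) ^ DIM('a)
    = std_gaussian_density (y /\<^sub>R sqrt (1 - r)) / sqrt (1 - r) ^ DIM('a)
      * (exp (- (r / (1 - r) / 2 * (norm z)\<^sup>2)) * exp (sqrt r / (1 - r) * (z \<bullet> y)))"
proof -
  have *: "(norm (v /\<^sub>R sqrt (1 - r)))\<^sup>2 = (norm v)\<^sup>2 / (1 - r)" for v :: 'a
    using r by (simp add: power_mult_distrib divide_inverse power_inverse)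
  have "(norm (y - sqrt r *\<^sub>R z))\<^sup>2 = (norm y)\<^sup>2 - 2 * sqrt r * (z \<bullet> y) + r * (norm z)\<^sup>2"
    using r by (simp only: power2_norm_eq_inner) (simp add: inner_diff_left inner_diff_right inner_commute[of y z] algebra_simps)
  then have "- (norm ((y - sqrt r *\<^sub>R z) /\<^sub>R sqrt (1 - r)))\<^sup>2 / 2
      = - (norm (y /\<^sub>R sqrt (1 - r)))\<^sup>2 / 2 + (- (r / (1 - r) / 2 * (norm z)\<^sup>2) + sqrt r / (1 - r) * (z \<bullet> y))"
    unfolding * using r by (simp add: diff_divide_distrib add_divide_distrib) (simp add: divide_simps)
  then have "exp (- (norm ((y - sqrt r *\<^sub>R z) /\<^sub>R sqrt (1 - r)))\<^sup>2 / 2)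
      = exp (- (norm (y /\<^sub>R sqrt (1 - r)))\<^sup>2 / 2) * (exp (- (r / (1 - r) / 2 * (norm z)\<^sup>2)) * exp (sqrt r / (1 - r) * (z \<bullet> y)))"
    by (simp only: exp_add)
  then show ?thesis
    by (simp only: std_gaussian_density_def) simp
qed

text \<open>The mean minimizes the quadratic deviation. If the right-hand side is finite, then \<open>f\<close> is integrable, so
  the default value of the Bochner integral never enters.\<close>

lemma (in prob_space) ext_variance_le:
  fixes f :: "'a \<Rightarrow> real"
  assumes [measurable]: "f \<in> borel_measurable M"
  shows "ext_variance M f \<le> (\<integral>\<^sup>+x. ennreal ((f x - a)\<^sup>2) \<partial>M)"
proof (cases "(\<integral>\<^sup>+x. ennreal ((f x - a)\<^sup>2) \<partial>M) = \<infinity>")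
  case True
  then show ?thesis by simp
next
  case False
  let ?g = "\<lambda>x. f x - a"
  have sq: "integrable M (\<lambda>x. (?g x)\<^sup>2)"
    using False by (intro integrableI_bounded) (auto simp: less_top)
  have g: "integrable M ?g"
    by (rule square_integrable_imp_integrable[OF _ sq]) measurable
  then have f: "integrable M f"
    using Bochner_Integration.integrable_add[OF g, of "\<lambda>_. a"] by simp
  define m where "m = (\<integral>x. f x \<partial>M)"
  have eq: "(f x - m)\<^sup>2 = (?g x)\<^sup>2 - 2 * (m - a) * ?g x + (m - a)\<^sup>2" for x
    by (simp add: power2_eq_square algebra_simps)
  have int: "integrable M (\<lambda>x. (f x - m)\<^sup>2)"
    unfolding eq using sq g by simp
  have "(\<integral>x. ?g x \<partial>M) = m - a"
    using f by (simp add: m_def prob_space)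
  moreover have "(\<integral>x. (f x - m)\<^sup>2 \<partial>M) = (\<integral>x. (?g x)\<^sup>2 \<partial>M) - 2 * (m - a) * (\<integral>x. ?g x \<partial>M) + (m - a)\<^sup>2"
    unfolding eq by (subst Bochner_Integration.integral_add Bochner_Integration.integral_diff,
      (intro Bochner_Integration.integrable_diff integrable_mult_right integrable_const sq g)+)+
      (simp add: prob_space del: Bochner_Integration.integral_diff)
  ultimately have "(\<integral>x. (f x - m)\<^sup>2 \<partial>M) = (\<integral>x. (?g x)\<^sup>2 \<partial>M) - (m - a)\<^sup>2"
    by (simp add: power2_eq_square)
  then have "(\<integral>x. (f x - m)\<^sup>2 \<partial>M) \<le> (\<integral>x. (?g x)\<^sup>2 \<partial>M)"
    by simp
  then show ?thesis
    using nn_integral_eq_integral[OF int] nn_integral_eq_integral[OF sq]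
    by (simp add: ext_variance_def m_def ennreal_leI)
qed

context gaussian_tilt
begin

lemma mass_measurable [measurable]: "laplace_transform base c (\<lambda>_. 1) \<in> borel_measurable borel"
  using times_differentiable_laplace_transform[OF base_moments, of "\<lambda>_. 1" 0 c]
  by (intro borel_measurable_continuous_onI) simp

lemma \<rho>_measurable2: "(\<lambda>x. \<rho> (fst x) (snd x)) \<in> borel_measurable (borel \<Otimes>\<^sub>M borel)"
  unfolding \<rho>_def by measurable

lemma nn_integral_tilt:
  assumes "u \<in> borel_measurable borel"
  shows "(\<integral>\<^sup>+z. u z \<partial>tilt y) = (\<integral>\<^sup>+z. ennreal (\<rho> y z) * u z \<partial>lborel)"
  using assms unfolding tilt_def by (subst nn_integral_density) auto

lemma nn_integral_tilt_measurable:
  assumes [measurable]: "case_prod \<Psi> \<in> borel_measurable (borel \<Otimes>\<^sub>M borel)"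
  shows "(\<lambda>y. \<integral>\<^sup>+z. \<Psi> z y \<partial>tilt y) \<in> borel_measurable borel"
proof -
  note [measurable] = \<rho>_measurable2
  have "(\<lambda>y. \<integral>\<^sup>+z. \<Psi> z y \<partial>tilt y) = (\<lambda>y. \<integral>\<^sup>+z. ennreal (\<rho> y z) * \<Psi> z y \<partial>lborel)"
    by (intro ext nn_integral_tilt) measurable
  then show ?thesis
    by simp
qed

end

text \<open>The case \<open>r = 1\<close> is excluded because the parameters \<open>r / (1 - r)\<close> and \<open>sqrt r / (1 - r)\<close> of the conditional
  laws blow up there.\<close>

locale gaussian_channel = prob_space M for M :: "'w measure" +
  fixes Z G :: "'w \<Rightarrow> 'a::euclidean_space" and p :: "'a \<Rightarrow> real" and r :: real
  assumes G: "distributed M lborel G (\<lambda>x. ennreal (std_gaussian_density x))"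
    and indep: "indep_var borel Z borel G"
    and Z_density: "distr M borel Z = density lborel p"
    and p_measurable: "p \<in> borel_measurable borel" and p_nonneg: "\<And>x. 0 \<le> p x"
    and p_concave: "\<And>x y. p x * p y \<le> (p ((x + y) /\<^sub>R 2))\<^sup>2"
    and r: "0 < r" "r < 1"
begin

lemma Z_measurable: "Z \<in> borel_measurable M" and G_measurable: "G \<in> borel_measurable M"
  using indep indep_var_rv1 indep_var_rv2 by blast+

sublocale gaussian_tilt p "r / (1 - r)" "sqrt r / (1 - r)"
proof (rule gaussian_tilt.intro)
  show "prob_space (density lborel p)"
    using prob_space_distr[OF Z_measurable] by (simp add: Z_density)
qed (use p_measurable p_nonneg p_concave r in auto)

definition Y :: "'w \<Rightarrow> 'a" where
  "Y \<omega> = sqrt r *\<^sub>R Z \<omega> + sqrt (1 - r) *\<^sub>R G \<omega>"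

definition Y_density :: "'a \<Rightarrow> ennreal" where
  "Y_density y = ennreal (std_gaussian_density (y /\<^sub>R sqrt (1 - r)) / sqrt (1 - r) ^ DIM('a) * mass y)"

lemma Y_measurable [measurable]: "Y \<in> borel_measurable M"
  using Z_measurable G_measurable unfolding Y_def[abs_def] by measurable

lemma Y_density_measurable [measurable]: "Y_density \<in> borel_measurable borel"
  unfolding Y_density_def[abs_def] by measurable

text \<open>This identifies \<open>tilt y\<close> as the conditional law of \<open>Z\<close> given \<open>Y = y\<close>, and \<open>Y_density\<close> as the density of
  \<open>Y\<close>. It suffices to exchange integrals in the joint law, since the joint density equals
  \<open>Y_density y * \<rho> y z\<close>.\<close>

lemma disintegration_density:
  assumes [measurable]: "case_prod \<Psi> \<in> borel_measurable (borel \<Otimes>\<^sub>M borel)"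
  shows "(\<integral>\<^sup>+\<omega>. \<Psi> (Z \<omega>) (Y \<omega>) \<partial>M) = (\<integral>\<^sup>+y. Y_density y * (\<integral>\<^sup>+z. \<Psi> z y \<partial>tilt y) \<partial>lborel)"
proof -
  note [measurable] = p_measurable \<rho>_measurable2
  let ?k = "\<lambda>z y. std_gaussian_density ((y - sqrt r *\<^sub>R z) /\<^sub>R sqrt (1 - r)) / sqrt (1 - r) ^ DIM('a)"
  have "(\<integral>\<^sup>+\<omega>. \<Psi> (Z \<omega>) (Y \<omega>) \<partial>M)
      = (\<integral>\<^sup>+z. \<integral>\<^sup>+y. ennreal (p z) * (ennreal (?k z y) * \<Psi> z y) \<partial>lborel \<partial>lborel)"
    unfolding Y_def using r
    by (intro joint_law_with_gaussian_noise prob_space_axioms G indep p_measurable Z_density assms) auto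
  also have "\<dots> = (\<integral>\<^sup>+y. \<integral>\<^sup>+z. ennreal (p z) * (ennreal (?k z y) * \<Psi> z y) \<partial>lborel \<partial>lborel)"
    by (rule lborel_pair.Fubini') measurable
  also have "\<dots> = (\<integral>\<^sup>+y. Y_density y * (\<integral>\<^sup>+z. \<Psi> z y \<partial>tilt y) \<partial>lborel)"
  proof (rule nn_integral_cong)
    fix y :: 'a
    let ?d = "std_gaussian_density (y /\<^sub>R sqrt (1 - r)) / sqrt (1 - r) ^ DIM('a)"
    have "ennreal (p z) * (ennreal (?k z y) * \<Psi> z y) = Y_density y * (ennreal (\<rho> y z) * \<Psi> z y)" for z
    proof -
      have "p z * ?k z y = ?d * mass y * \<rho> y z"
        unfolding gaussian_kernel_factorization[OF r] \<rho>_def using mass_pos[of y] by simp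
      then have "ennreal (p z) * ennreal (?k z y) = Y_density y * ennreal (\<rho> y z)"
        using r p_nonneg \<rho>_nonneg mass_pos[of y] unfolding Y_density_def
        by (simp add: ennreal_mult[symmetric] std_gaussian_density_nonneg less_imp_le)
      then show ?thesis
        by (simp add: mult.assoc[symmetric])
    qed
    then have "(\<integral>\<^sup>+z. ennreal (p z) * (ennreal (?k z y) * \<Psi> z y) \<partial>lborel)
        = (\<integral>\<^sup>+z. Y_density y * (ennreal (\<rho> y z) * \<Psi> z y) \<partial>lborel)"
      by simp
    also have "\<dots> = Y_density y * (\<integral>\<^sup>+z. \<Psi> z y \<partial>tilt y)"
      by (subst nn_integral_tilt, measurable) (rule nn_integral_cmult, measurable)
    finally show "(\<integral>\<^sup>+z. ennreal (p z) * (ennreal (?k z y) * \<Psi> z y) \<partial>lborel) = Y_density y * (\<integral>\<^sup>+z. \<Psi> z y \<partial>tilt y)" .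
  qed
  finally show ?thesis .
qed

lemma nn_integral_Y:
  assumes [measurable]: "\<psi> \<in> borel_measurable borel"
  shows "(\<integral>\<^sup>+y. \<psi> y \<partial>distr M borel Y) = (\<integral>\<^sup>+y. Y_density y * \<psi> y \<partial>lborel)"
proof -
  have "(\<integral>\<^sup>+z. \<psi> y \<partial>tilt y) = \<psi> y" for y
  proof -
    interpret tilt: prob_space "tilt y" by (rule tilt_prob)
    show ?thesis by (simp add: tilt.emeasure_space_1)
  qed
  then show ?thesis
    using disintegration_density[of "\<lambda>_ y. \<psi> y"] by (simp add: nn_integral_distr)
qed

theorem disintegration:
  assumes [measurable]: "\<phi> \<in> borel_measurable borel"
  shows "(\<integral>\<^sup>+z. \<phi> z \<partial>distr M borel Z) = (\<integral>\<^sup>+y. (\<integral>\<^sup>+z. \<phi> z \<partial>tilt y) \<partial>distr M borel Y)"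
proof -
  have "(\<integral>\<^sup>+z. \<phi> z \<partial>distr M borel Z) = (\<integral>\<^sup>+\<omega>. \<phi> (Z \<omega>) \<partial>M)"
    using Z_measurable by (simp add: nn_integral_distr)
  also have "\<dots> = (\<integral>\<^sup>+y. Y_density y * (\<integral>\<^sup>+z. \<phi> z \<partial>tilt y) \<partial>lborel)"
    by (rule disintegration_density) measurable
  also have "\<dots> = (\<integral>\<^sup>+y. (\<integral>\<^sup>+z. \<phi> z \<partial>tilt y) \<partial>distr M borel Y)"
    by (rule nn_integral_Y[symmetric], rule nn_integral_tilt_measurable) measurable
  finally show ?thesis .
qed

text \<open>The law of total variance, taken around the mean \<open>a\<close> of \<open>F Y\<close>. Working with the extended-valued integral of
  \<open>(f - a)^2\<close> makes the decomposition valid even when \<open>f\<close> is not known to be square integrable.\<close>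

theorem poincare_inequality_transfer:
  assumes C: "poincare_inequality (distr M borel Y) C"
  shows "poincare_inequality (distr M borel Z) (ennreal (1 / r) * C + ennreal (1 / r - 1))"
  unfolding poincare_inequality_def
proof (intro allI impI, elim conjE exE)
  fix f :: "'a \<Rightarrow> real" and L assume f: "L-lipschitz_on UNIV f" and smooth: "smooth f"
  let ?\<nu> = "distr M borel Z" and ?\<eta> = "distr M borel Y" and ?F = "tilt_mean f"
  let ?D = "\<lambda>x. gradient f x" and ?\<kappa> = "r / (1 - r)"
  note D = smooth_GDERIV[OF smooth]
  have f_growth: "exp_growth f"
    by (rule exp_growth_lipschitz[OF f])
  note [measurable] = lipschitz_measurable[OF f] GDERIV_norm_measurable[OF f D]
  have D_growth: "exp_growth (\<lambda>x. (norm (?D x))\<^sup>2)"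
    using GDERIV_norm_le[OF f D] GDERIV_norm_measurable[OF f D]
    by (intro exp_growthI[where K="L\<^sup>2" and a=0]) auto
  define a where "a = (\<integral>y. ?F y \<partial>?\<eta>)"
  define E where "E = (\<integral>\<^sup>+x. ennreal ((norm (?D x))\<^sup>2) \<partial>?\<nu>)"
  have E_eq: "E = (\<integral>\<^sup>+y. (\<integral>\<^sup>+x. ennreal ((norm (?D x))\<^sup>2) \<partial>tilt y) \<partial>?\<eta>)"
    unfolding E_def by (rule disintegration) measurable
  have E_tilt: "(\<integral>\<^sup>+x. ennreal ((norm (?D x))\<^sup>2) \<partial>tilt y) = ennreal (\<integral>x. (norm (?D x))\<^sup>2 \<partial>tilt y)" for y
    by (intro nn_integral_eq_integral tilt_integrable D_growth) auto
  have E_meas [measurable]: "(\<lambda>y. \<integral>\<^sup>+x. ennreal ((norm (?D x))\<^sup>2) \<partial>tilt y) \<in> borel_measurable borel"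
    by (intro nn_integral_tilt_measurable) measurable
  note F_smooth = smooth_tilt_mean[OF f_growth]
  note F_lip = tilt_mean_lipschitz[OF f D]
  note [measurable] = lipschitz_measurable[OF F_lip]
  have grad: "ennreal ((norm (gradient ?F y))\<^sup>2) \<le> ennreal (1 / r) * (\<integral>\<^sup>+x. ennreal ((norm (?D x))\<^sup>2) \<partial>tilt y)" for y
  proof -
    have "(sqrt r / (1 - r) / ?\<kappa>)\<^sup>2 = 1 / r"
      using r by (simp add: power_divide) (simp add: power2_eq_square)
    then have "(norm (gradient ?F y))\<^sup>2 \<le> 1 / r * (\<integral>x. (norm (?D x))\<^sup>2 \<partial>tilt y)"
      using tilt_mean_gradient_bound[OF f D smooth_GDERIV[OF F_smooth], of y] by simp
    then show ?thesis
      unfolding E_tilt using r by (simp add: ennreal_mult'[symmetric] ennreal_leI)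
  qed
  have "ext_variance ?\<eta> ?F \<le> C * (\<integral>\<^sup>+y. ennreal ((norm (gradient ?F y))\<^sup>2) \<partial>?\<eta>)"
    using C F_smooth F_lip unfolding poincare_inequality_def by blast
  also have "\<dots> \<le> C * (\<integral>\<^sup>+y. ennreal (1 / r) * (\<integral>\<^sup>+x. ennreal ((norm (?D x))\<^sup>2) \<partial>tilt y) \<partial>?\<eta>)"
    by (intro mult_left_mono nn_integral_mono grad) simp
  also have "\<dots> = C * (ennreal (1 / r) * E)"
    unfolding E_eq by (subst nn_integral_cmult) simp_all
  finally have between: "(\<integral>\<^sup>+y. ennreal ((?F y - a)\<^sup>2) \<partial>?\<eta>) \<le> C * (ennreal (1 / r) * E)"
    by (simp add: ext_variance_def a_def)
  \<comment> \<open>Split the deviation from \<open>a\<close> into the deviation from the conditional mean and the constant \<open>F y - a\<close>; the cross term vanishes.\<close>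
  have within: "(\<integral>\<^sup>+x. ennreal ((f x - a)\<^sup>2) \<partial>tilt y)
      \<le> ennreal (1 / r - 1) * (\<integral>\<^sup>+x. ennreal ((norm (?D x))\<^sup>2) \<partial>tilt y) + ennreal ((?F y - a)\<^sup>2)" for y
  proof -
    interpret tilt: prob_space "tilt y" by (rule tilt_prob)
    let ?u = "\<lambda>x. f x - ?F y"
    have u: "exp_growth ?u"
      by (intro exp_growth_intros f_growth)
    have u0: "(\<integral>x. ?u x \<partial>tilt y) = 0"
      using tilt_integrable[OF f_growth] by (simp add: tilt_mean_def tilt.prob_space)
    have "(\<integral>x. (f x - a)\<^sup>2 \<partial>tilt y) = (\<integral>x. (?u x)\<^sup>2 + 2 * (?F y - a) * ?u x + (?F y - a)\<^sup>2 \<partial>tilt y)"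
      by (intro Bochner_Integration.integral_cong refl) (simp add: power2_eq_square algebra_simps)
    also have "\<dots> = (\<integral>x. (?u x)\<^sup>2 \<partial>tilt y) + 2 * (?F y - a) * (\<integral>x. ?u x \<partial>tilt y) + (?F y - a)\<^sup>2"
      using tilt_integrable[OF u] tilt_integrable[OF exp_growth_power[OF u, of 2]]
      by (simp add: tilt.prob_space)
    also have "\<dots> \<le> (1 / r - 1) * (\<integral>x. (norm (?D x))\<^sup>2 \<partial>tilt y) + (?F y - a)\<^sup>2"
      using tilt_poincare[OF f D, of y] r unfolding u0 by (simp add: tilt_mean_def field_simps)
    finally have "ennreal (\<integral>x. (f x - a)\<^sup>2 \<partial>tilt y)
        \<le> ennreal ((1 / r - 1) * (\<integral>x. (norm (?D x))\<^sup>2 \<partial>tilt y) + (?F y - a)\<^sup>2)"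
      by (rule ennreal_leI)
    also have "\<dots> = ennreal (1 / r - 1) * ennreal (\<integral>x. (norm (?D x))\<^sup>2 \<partial>tilt y) + ennreal ((?F y - a)\<^sup>2)"
      using r by (simp add: ennreal_mult integral_nonneg_AE)
    finally show ?thesis
      unfolding E_tilt
      by (subst nn_integral_eq_integral) (auto intro!: tilt_integrable exp_growth_intros f_growth)
  qed
  interpret \<nu>: prob_space ?\<nu>
    by (rule prob_space_distr[OF Z_measurable])
  have "ext_variance ?\<nu> f \<le> (\<integral>\<^sup>+x. ennreal ((f x - a)\<^sup>2) \<partial>?\<nu>)"
    by (rule \<nu>.ext_variance_le) simp
  also have "\<dots> = (\<integral>\<^sup>+y. (\<integral>\<^sup>+x. ennreal ((f x - a)\<^sup>2) \<partial>tilt y) \<partial>?\<eta>)"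
    by (rule disintegration) measurable
  also have "\<dots> \<le> (\<integral>\<^sup>+y. ennreal (1 / r - 1) * (\<integral>\<^sup>+x. ennreal ((norm (?D x))\<^sup>2) \<partial>tilt y) + ennreal ((?F y - a)\<^sup>2) \<partial>?\<eta>)"
    by (intro nn_integral_mono within)
  also have "\<dots> = ennreal (1 / r - 1) * E + (\<integral>\<^sup>+y. ennreal ((?F y - a)\<^sup>2) \<partial>?\<eta>)"
    unfolding E_eq by (subst nn_integral_add) (simp_all add: nn_integral_cmult)
  also have "\<dots> \<le> ennreal (1 / r - 1) * E + C * (ennreal (1 / r) * E)"
    by (intro add_left_mono between)
  also have "\<dots> = (ennreal (1 / r) * C + ennreal (1 / r - 1)) * E"
    by (simp add: distrib_right distrib_left ac_simps)
  finally show "ext_variance ?\<nu> f \<le> (ennreal (1 / r) * C + ennreal (1 / r - 1)) * (\<integral>\<^sup>+x. ennreal ((norm (gradient f x))\<^sup>2) \<partial>?\<nu>)"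
    by (simp add: E_def)
qed

end

section \<open>Poincare constants under Gaussian noise\<close>

text \<open>Midpoint convexity of \<open>V\<close> is turned into midpoint log-concavity of a real-valued density \<open>p\<close>, the
  form in which the Prekopa-Leindler inequality uses it.\<close>

lemma log_concave_measureE:
  fixes \<nu> :: "'a::euclidean_space measure"
  assumes "log_concave_measure \<nu>"
  obtains p :: "'a \<Rightarrow> real" where "p \<in> borel_measurable borel" "\<And>x. 0 \<le> p x" "\<nu> = density lborel p"
    "\<And>x y. p x * p y \<le> (p ((x + y) /\<^sub>R 2))\<^sup>2"
proof -
  from assms obtain V where V [measurable]: "V \<in> borel_measurable borel" and convex: "convex_ereal V"
    and \<nu>: "\<nu> = density lborel (\<lambda>x. exp_neg (V x))"
    unfolding log_concave_measure_def by blast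
  define p where "p x = (if V x = \<infinity> then 0 else exp (- real_of_ereal (V x)))" for x
  have "exp_neg (V x) = ennreal (p x)" for x
    by (simp add: exp_neg_def p_def)
  then have "\<nu> = density lborel p"
    by (simp add: \<nu>)
  moreover have "p \<in> borel_measurable borel"
    unfolding p_def[abs_def] by measurable
  moreover have "p x * p y \<le> (p ((x + y) /\<^sub>R 2))\<^sup>2" for x y
  proof (cases "V x = \<infinity> \<or> V y = \<infinity>")
    case True
    then show ?thesis by (auto simp: p_def)
  next
    case False
    have fin: "V z \<noteq> - \<infinity>" for z
      using convex by (simp add: convex_ereal_def)
    obtain a b where ab: "V x = ereal a" "V y = ereal b"
      using False fin[of x] fin[of y] by (metis ereal_cases)
    have "\<forall>t\<in>{0..1}. V ((1 - t) *\<^sub>R x + t *\<^sub>R y) \<le> ereal (1 - t) * V x + ereal t * V y"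
      using convex by (simp add: convex_ereal_def)
    from bspec[OF this, of "1 / 2"]
    have "V ((x + y) /\<^sub>R 2) \<le> ereal ((a + b) / 2)"
      by (simp add: ab scaleR_add_right add_divide_distrib)
    then obtain m where m: "V ((x + y) /\<^sub>R 2) = ereal m" "2 * m \<le> a + b"
      using fin[of "(x + y) /\<^sub>R 2"] by (cases "V ((x + y) /\<^sub>R 2)") auto
    have "exp (- a) * exp (- b) \<le> (exp (- m))\<^sup>2"
      using m(2) by (simp add: exp_add[symmetric] power2_eq_square)
    then show ?thesis
      by (simp only: p_def ab m) simp
  qed
  ultimately show ?thesis
    by (intro that[of p]) (auto simp: p_def)
qed

theorem theorem4p10:
  fixes M :: "'w measure" and Z G :: "'w \<Rightarrow> real ^ 'n" and r :: real
  assumes "prob_space M"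
    and "Z \<in> borel_measurable M"
    and "log_concave_measure (distr M borel Z)"
    and "distributed M lborel G (\<lambda>x. ennreal (std_gaussian_density x))"
    and "prob_space.indep_var M borel Z borel G"
    and "0 < r" and "r \<le> 1"
  shows "poincare_constant (distr M borel Z)
    \<le> ennreal (1 / r) *
        poincare_constant (distr M borel (\<lambda>\<omega>. sqrt r *\<^sub>R Z \<omega> + sqrt (1 - r) *\<^sub>R G \<omega>))
      + ennreal (1 / r - 1)"
proof (cases "r = 1")
  case True
  then show ?thesis by simp
next
  case False
  obtain p :: "real ^ 'n \<Rightarrow> real" where p: "p \<in> borel_measurable borel" "\<And>x. 0 \<le> p x"
    "distr M borel Z = density lborel p" "\<And>x y. p x * p y \<le> (p ((x + y) /\<^sub>R 2))\<^sup>2"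
    using log_concave_measureE[OF assms(3)] by blast
  interpret gaussian_channel M Z G p r
    unfolding gaussian_channel_def gaussian_channel_axioms_def
    using assms p False by auto
  let ?c = "poincare_constant (distr M borel Z)" and ?Y = "distr M borel Y"
  \<comment> \<open>Solved for \<open>C\<close>, the transferred inequality survives the infimum, also if no \<open>C\<close> is admissible.\<close>
  have "ennreal r * (?c - ennreal (1 / r - 1)) \<le> C" if "poincare_inequality ?Y C" for C
  proof -
    have "?c \<le> ennreal (1 / r) * C + ennreal (1 / r - 1)"
      unfolding poincare_constant_def by (rule Inf_lower) (simp add: poincare_inequality_transfer that)
    then have "?c - ennreal (1 / r - 1) \<le> ennreal (1 / r) * C"
      by (simp add: ennreal_minus_le_iff add.commute)
    then have "ennreal r * (?c - ennreal (1 / r - 1)) \<le> ennreal r * (ennreal (1 / r) * C)"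
      by (rule mult_left_mono) simp
    then show ?thesis
      using r by (simp add: mult.assoc[symmetric] ennreal_mult[symmetric])
  qed
  then have "ennreal r * (?c - ennreal (1 / r - 1)) \<le> poincare_constant ?Y"
    unfolding poincare_constant_def[of ?Y] by (intro Inf_greatest) auto
  then have "ennreal (1 / r) * (ennreal r * (?c - ennreal (1 / r - 1))) \<le> ennreal (1 / r) * poincare_constant ?Y"
    by (rule mult_left_mono) simp
  then have "?c - ennreal (1 / r - 1) \<le> ennreal (1 / r) * poincare_constant ?Y"
    using r by (simp add: mult.assoc[symmetric] ennreal_mult[symmetric])
  then have "?c \<le> ennreal (1 / r) * poincare_constant ?Y + ennreal (1 / r - 1)"
    by (simp add: ennreal_minus_le_iff add.commute)
  then show ?thesis
    by (simp add: Y_def[abs_def])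
qed

end
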